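(* Let $d\ge 4$ and let $\Delta$ be an $\mathbb{F}$-tight, connected, closed $\mathbb{F}$-homology $d$-manifold such that $\beta_i(\Delta;\mathbb{F})=0$ for all $1<i<d-1$. Then $\Delta$ is locally stacked, i.e. every vertex link ${\rm lk}_\Delta(v)$ is a stacked homology $(d-1)$-sphere.
   Context: Fix a field $\mathbb{F}$; all homology is over $\mathbb{F}$ and $\beta_i(\Delta;\mathbb{F})=\dim_{\mathbb{F}}\widetilde H_i(\Delta;\mathbb{F})$. For a face $\sigma$ of $\Delta$, ${\rm lk}_\Delta(\sigma)=\{\tau\setminus\sigma:\sigma\subseteq\tau\in\Delta\}$; for $W\subseteq V$ (the vertex set), $\Delta[W]=\{\alpha\in\Delta:\alpha\subseteq W\}$. A $d$-dimensional simplicial complex $S$ is a homology $d$-sphere if for every face $\sigma$ of dimension $i\ge -1$, ${\rm lk}_S(\sigma)$ has the same $\mathbb{F}$-homology as the $(d-i-1)$-sphere. A $d$-dimensional complex $B$ is a homology $d$-ball if (i) $B$ has trivial reduced homology, (ii) for each face $\sigma$ of dimension $i\le d-1$ the reduced homology of ${\rm lk}_B(\sigma)$ is trivial or that of the $(d-i-1)$-sphere, (iii) $\partial B=\{\sigma\in B:-1<\dim\sigma<d,\ \widetilde H_{d-\dim\sigma-1}({\rm lk}_B(\sigma))=0\}\cup\{\emptyset\}$ is a homology $(d-1)$-sphere. A homology $d$-manifold is a complex whose vertex links are homology $(d-1)$-spheres or balls; its boundary is defined by the same formula; it is closed if $\partial\Delta=\{\emptyset\}$ and "with boundary" otherwise;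 interior faces are faces not in $\partial\Delta$. A homology $d$-manifold with boundary is stacked if all its interior faces have dimension $\ge d-1$; a closed homology $d$-manifold (in particular a homology sphere) is stacked if it is the boundary of a stacked homology $(d+1)$-manifold with boundary. A homology $d$-manifold is locally stacked if each vertex link is a stacked homology $(d-1)$-sphere or stacked homology $(d-1)$-ball. $\Delta$ is $\mathbb{F}$-tight if it is connected and for every $W\subseteq V$ and every $i\ge0$ the map $\widetilde H_i(\Delta[W];\mathbb{F})\to\widetilde H_i(\Delta;\mathbb{F})$ induced by inclusion is injective. *)

theory Defs
  imports Complex_Main "HOL-Library.Function_Algebras"
begin

definition simplicial_complex :: "'a set set \<Rightarrow> bool" where
  "simplicial_complex K \<longleftrightarrow> finite K \<and> (\<forall>\<sigma>\<in>K. \<forall>\<tau>. \<tau> \<subseteq> \<sigma> \<longrightarrow> \<tau> \<in> K)"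

definition fdim :: "'a set \<Rightarrow> int" where
  "fdim \<sigma> = int (card \<sigma>) - 1"

definition cdim :: "'a set set \<Rightarrow> int" where
  "cdim K = int (Max (card ` K)) - 1"

definition vertices :: "'a set set \<Rightarrow> 'a set" where
  "vertices K = {v. {v} \<in> K}"

definition link :: "'a set set \<Rightarrow> 'a set \<Rightarrow> 'a set set" where
  "link K \<sigma> = {\<tau> - \<sigma> | \<tau>. \<tau> \<in> K \<and> \<sigma> \<subseteq> \<tau>}"

definition induced :: "'a set set \<Rightarrow> 'a set \<Rightarrow> 'a set set" where
  "induced K W = {\<alpha> \<in> K. \<alpha> \<subseteq> W}"

definition connected_complex :: "'a set set \<Rightarrow> bool" where
  "connected_complex K \<longleftrightarrow> vertices K \<noteq> {} \<and>
     (\<forall>u\<in>vertices K. \<forall>v\<in>vertices K. (\<lambda>x y. {x, y} \<in> K)\<^sup>*\<^sup>* u v)"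

text \<open>Chains are indexed by the cardinality k of faces (k = dim + 1), so the
  k-th chain group corresponds to dimension k-1; k = 0 is the augmentation
  (empty face). Coefficients lie in the field type 'k; faces are oriented by
  the linear order of the vertex type.\<close>

definition faces_card :: "'a set set \<Rightarrow> nat \<Rightarrow> 'a set set" where
  "faces_card K k = {\<sigma> \<in> K. finite \<sigma> \<and> card \<sigma> = k}"

definition chains :: "'k::field itself \<Rightarrow> 'a set set \<Rightarrow> nat \<Rightarrow> ('a set \<Rightarrow> 'k) set" where
  "chains F K k = {c. \<forall>\<sigma>. c \<sigma> \<noteq> 0 \<longrightarrow> \<sigma> \<in> faces_card K k}"

definition incidence :: "'a::linorder set \<Rightarrow> 'a set \<Rightarrow> 'k::field" where
  "incidence \<tau> \<sigma> = (- 1) ^ card {x \<in> \<tau>. x < the_elem (\<sigma> - \<tau>)}"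

definition bd :: "'a::linorder set set \<Rightarrow> nat \<Rightarrow> ('a set \<Rightarrow> 'k::field) \<Rightarrow> ('a set \<Rightarrow> 'k)" where
  "bd K k c = (\<lambda>\<tau>. if 1 \<le> k \<and> \<tau> \<in> faces_card K (k - 1)
      then (\<Sum>\<sigma>\<in>{\<sigma> \<in> faces_card K k. \<tau> \<subset> \<sigma>}. incidence \<tau> \<sigma> * c \<sigma>) else 0)"

definition cycles :: "'k::field itself \<Rightarrow> 'a::linorder set set \<Rightarrow> nat \<Rightarrow> ('a set \<Rightarrow> 'k) set" where
  "cycles F K k = {c \<in> chains F K k. bd K k c = 0}"

definition boundaries :: "'k::field itself \<Rightarrow> 'a::linorder set set \<Rightarrow> nat \<Rightarrow> ('a set \<Rightarrow> 'k) set" where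
  "boundaries F K k = bd K (Suc k) ` chains F K (Suc k)"

definition chain_dim :: "'k::field itself \<Rightarrow> ('a set \<Rightarrow> 'k) set \<Rightarrow> nat" where
  "chain_dim F V = vector_space.dim (\<lambda>(a::'k) f. (\<lambda>x. a * f x)) V"

definition rbetti :: "'k::field itself \<Rightarrow> 'a::linorder set set \<Rightarrow> nat \<Rightarrow> nat" where
  "rbetti F K k = chain_dim F (cycles F K k) - chain_dim F (boundaries F K k)"

definition betti :: "'k::field itself \<Rightarrow> 'a::linorder set set \<Rightarrow> int \<Rightarrow> nat" where
  "betti F K i = (if i < -1 then 0 else rbetti F K (nat (i + 1)))"

definition acyclic :: "'k::field itself \<Rightarrow> 'a::linorder set set \<Rightarrow> bool" where
  "acyclic F K \<longleftrightarrow> (\<forall>i. betti F K i = 0)"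

definition sphere_homology :: "'k::field itself \<Rightarrow> 'a::linorder set set \<Rightarrow> int \<Rightarrow> bool" where
  "sphere_homology F K m \<longleftrightarrow> (\<forall>i. betti F K i = (if i = m then 1 else 0))"

definition hom_sphere :: "'k::field itself \<Rightarrow> 'a::linorder set set \<Rightarrow> int \<Rightarrow> bool" where
  "hom_sphere F S d \<longleftrightarrow> simplicial_complex S \<and> S \<noteq> {} \<and> cdim S = d \<and>
     (\<forall>\<sigma>\<in>S. sphere_homology F (link S \<sigma>) (d - fdim \<sigma> - 1))"

definition hbdry :: "'k::field itself \<Rightarrow> 'a::linorder set set \<Rightarrow> int \<Rightarrow> 'a set set" where
  "hbdry F K d = {\<sigma> \<in> K. -1 < fdim \<sigma> \<and> fdim \<sigma> < d \<and>
                      betti F (link K \<sigma>) (d - fdim \<sigma> - 1) = 0} \<union> {{}}"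

definition hom_ball :: "'k::field itself \<Rightarrow> 'a::linorder set set \<Rightarrow> int \<Rightarrow> bool" where
  "hom_ball F B d \<longleftrightarrow> simplicial_complex B \<and> B \<noteq> {} \<and> cdim B = d \<and> acyclic F B \<and>
     (\<forall>\<sigma>\<in>B. fdim \<sigma> \<le> d - 1 \<longrightarrow>
        acyclic F (link B \<sigma>) \<or> sphere_homology F (link B \<sigma>) (d - fdim \<sigma> - 1)) \<and>
     hom_sphere F (hbdry F B d) (d - 1)"

definition hom_manifold :: "'k::field itself \<Rightarrow> 'a::linorder set set \<Rightarrow> int \<Rightarrow> bool" where
  "hom_manifold F K d \<longleftrightarrow> simplicial_complex K \<and> K \<noteq> {} \<and> cdim K = d \<and>
     (\<forall>v\<in>vertices K. hom_sphere F (link K {v}) (d - 1) \<or> hom_ball F (link K {v}) (d - 1))"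

definition closed_manifold :: "'k::field itself \<Rightarrow> 'a::linorder set set \<Rightarrow> int \<Rightarrow> bool" where
  "closed_manifold F K d \<longleftrightarrow> hom_manifold F K d \<and> hbdry F K d = {{}}"

definition stacked_with_boundary :: "'k::field itself \<Rightarrow> 'a::linorder set set \<Rightarrow> int \<Rightarrow> bool" where
  "stacked_with_boundary F K d \<longleftrightarrow> hom_manifold F K d \<and> hbdry F K d \<noteq> {{}} \<and>
     (\<forall>\<sigma>\<in>K. \<sigma> \<notin> hbdry F K d \<longrightarrow> fdim \<sigma> \<ge> d - 1)"

definition stacked_closed :: "'k::field itself \<Rightarrow> 'a::linorder set set \<Rightarrow> int \<Rightarrow> bool" where
  "stacked_closed F K d \<longleftrightarrow> closed_manifold F K d \<and>
     (\<exists>B. stacked_with_boundary F B (d + 1) \<and> hbdry F B (d + 1) = K)"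

definition stacked_sphere :: "'k::field itself \<Rightarrow> 'a::linorder set set \<Rightarrow> int \<Rightarrow> bool" where
  "stacked_sphere F S d \<longleftrightarrow> hom_sphere F S d \<and> stacked_closed F S d"

definition stacked_ball :: "'k::field itself \<Rightarrow> 'a::linorder set set \<Rightarrow> int \<Rightarrow> bool" where
  "stacked_ball F B d \<longleftrightarrow> hom_ball F B d \<and> stacked_with_boundary F B d"

definition locally_stacked :: "'k::field itself \<Rightarrow> 'a::linorder set set \<Rightarrow> int \<Rightarrow> bool" where
  "locally_stacked F K d \<longleftrightarrow> hom_manifold F K d \<and>
     (\<forall>v\<in>vertices K. stacked_sphere F (link K {v}) (d - 1) \<or> stacked_ball F (link K {v}) (d - 1))"

text \<open>The map H_i(K[W]) \<rightarrow> H_i(K) induced by inclusion is injective iff every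
  cycle of K[W] that is a boundary in K is already a boundary in K[W].
  Index k = i + 1 (cardinality of faces), i \<ge> 0.\<close>
definition tight :: "'k::field itself \<Rightarrow> 'a::linorder set set \<Rightarrow> bool" where
  "tight F K \<longleftrightarrow> connected_complex K \<and>
     (\<forall>W \<subseteq> vertices K. \<forall>k\<ge>1. \<forall>c.
        c \<in> cycles F (induced K W) k \<and> c \<in> boundaries F K k \<longrightarrow> c \<in> boundaries F (induced K W) k)"

end

theory Submission
  imports Defs
begin

text \<open>
  Let \<open>S\<close> be the link of a vertex \<open>v\<close>, a homology \<open>(d - 1)\<close>-sphere. A cycle \<open>c\<close> of an induced
  subcomplex \<open>S[W]\<close> bounds the cone over it with apex \<open>v\<close>; tightness gives a second filling in
  \<open>K[W - v]\<close>, and their difference is a cycle of \<open>K[W + v]\<close> which bounds there when the Betti number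
  in question vanishes. Taking links at \<open>v\<close> shows that \<open>c\<close> bounds in \<open>S[W]\<close>. Hence all induced
  subcomplexes of \<open>S\<close> have zero homology in degrees \<open>1, \<dots>, d - 3\<close>.

  Such a sphere has a chordal graph, hence a simplicial vertex \<open>w\<close>; having no missing faces of
  intermediate size forces the link of \<open>w\<close> to be the boundary of a simplex \<open>G\<close> with \<open>d\<close> vertices.
  If \<open>G\<close> is a face, then \<open>S\<close> is the boundary of the simplex on \<open>w\<close> and \<open>G\<close>. Otherwise replacing the
  star of \<open>w\<close> by \<open>G\<close> gives a smaller sphere of the same kind, and attaching the simplex on \<open>w\<close> and
  \<open>G\<close> to a stacked ball bounded by the latter yields one bounded by \<open>S\<close>.
\<close>

subsection \<open>Chains and the boundary operator\<close>

text \<open>The homological input leaves two gaps. Filling a cycle of size \<open>k\<close> in the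
  link of \<open>v\<close> uses the vanishing of \<open>K\<close> at size \<open>k + 1\<close>,
  which holds only for \<open>3 \<le> k + 1 < n\<close> with \<open>n = d\<close>. So nothing is
  known about connectedness of induced subcomplexes of the link (\<open>k = 1\<close>), nor about
  the size \<open>k = n - 1\<close>. The first gap is harmless: chordality needs only
  \<open>k = 2\<close>, which lies in the range because \<open>d \<ge> 4\<close>. The second is the
  obstacle: in the link of a simplicial vertex, missing-face arguments produce only the faces with
  at most \<open>n - 2\<close> vertices, while the facets have \<open>n - 1\<close>. These come from
  duality in that link, whose graph is complete, and from the fact that the fundamental cycle of a
  homology sphere is nonzero on every facet. Homology is handled by explicit fillings of cycles;
  dimensions of chain spaces appear only where Betti numbers are translated.\<close>

definition ins_sign :: "'a::linorder \<Rightarrow> 'a set \<Rightarrow> 'k::field" where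
  "ins_sign x \<tau> = (- 1) ^ card {y \<in> \<tau>. y < x}"

lemma ins_sign_square [simp]: "ins_sign x \<tau> * ins_sign x \<tau> = (1::'k::field)"
  by (simp add: ins_sign_def flip: power_mult_distrib)

lemma ins_sign_square_left [simp]: "ins_sign x \<tau> * (ins_sign x \<tau> * a) = (a::'k::field)"
  by (simp flip: mult.assoc)

lemma ins_sign_nonzero [simp]: "ins_sign x \<tau> \<noteq> (0::'k::field)"
  by (simp add: ins_sign_def)

lemma ins_sign_insert:
  assumes "finite \<tau>" "x \<notin> \<tau>"
  shows "ins_sign y (insert x \<tau>) = (if x < y then - ins_sign y \<tau> else (ins_sign y \<tau> :: 'k::field))"
proof -
  have *: "{z \<in> insert x \<tau>. z < y} = (if x < y then insert x {z \<in> \<tau>. z < y} else {z \<in> \<tau>. z < y})"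
    by auto
  show ?thesis
    unfolding ins_sign_def * using assms by simp
qed

text \<open>Exactly one of \<open>x < y\<close> and \<open>y < x\<close> holds, so exactly one side
  picks up an additional factor -1. The sign computations for \<open>bdry\<close> rest on this
  rule.\<close>

lemma ins_sign_swap:
  assumes "finite \<tau>" "x \<notin> \<tau>" "y \<notin> \<tau>" "x \<noteq> y"
  shows "ins_sign x \<tau> * ins_sign y (insert x \<tau>) = - (ins_sign y \<tau> * (ins_sign x (insert y \<tau>) :: 'k::field))"
  using assms by (auto simp: ins_sign_insert)

definition cone :: "'a::linorder \<Rightarrow> ('a set \<Rightarrow> 'k::field) \<Rightarrow> 'a set \<Rightarrow> 'k" where
  "cone x c \<sigma> = (if x \<in> \<sigma> then ins_sign x (\<sigma> - {x}) * c (\<sigma> - {x}) else 0)"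

text \<open>The sign is the one that \<open>cone\<close> inserts, so that
  \<open>c = avoidpart x c + cone x (linkpart x c)\<close> holds for every function
  \<open>c\<close>, whatever its support.\<close>

definition linkpart :: "'a::linorder \<Rightarrow> ('a set \<Rightarrow> 'k::field) \<Rightarrow> 'a set \<Rightarrow> 'k" where
  "linkpart x c \<rho> = (if x \<in> \<rho> then 0 else ins_sign x \<rho> * c (insert x \<rho>))"

definition avoidpart :: "'a::linorder \<Rightarrow> ('a set \<Rightarrow> 'k::field) \<Rightarrow> 'a set \<Rightarrow> 'k" where
  "avoidpart x c \<sigma> = (if x \<in> \<sigma> then 0 else c \<sigma>)"

definition scal :: "'k::field \<Rightarrow> ('a set \<Rightarrow> 'k) \<Rightarrow> 'a set \<Rightarrow> 'k" where
  "scal a c \<sigma> = a * c \<sigma>"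

definition unit_chain :: "'a set \<Rightarrow> 'a set \<Rightarrow> 'k::field" where
  "unit_chain \<sigma> \<tau> = (if \<tau> = \<sigma> then 1 else 0)"

lemma avoidpart_plus_cone_linkpart: "avoidpart x c + cone x (linkpart x c) = c"
  by (rule ext) (auto simp: avoidpart_def cone_def linkpart_def insert_absorb)

lemma linkpart_cone:
  assumes "\<And>\<sigma>. x \<in> \<sigma> \<Longrightarrow> c \<sigma> = 0"
  shows "linkpart x (cone x c) = c"
  using assms by (auto simp: linkpart_def cone_def)

lemma linkpart_eq_0: "(\<And>\<sigma>. x \<in> \<sigma> \<Longrightarrow> c \<sigma> = 0) \<Longrightarrow> linkpart x c = 0"
  by (auto simp: linkpart_def)

lemma linkpart_diff: "linkpart x (b - c) = linkpart x b - linkpart x c"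
  by (auto simp: linkpart_def algebra_simps)

lemma cone_0 [simp]: "cone x 0 = 0" and linkpart_0 [simp]: "linkpart x 0 = 0"
  and scal_0 [simp]: "scal a 0 = 0"
  by (auto simp: cone_def linkpart_def scal_def)

lemma cone_minus: "cone x (- c) = - cone x c"
  by (auto simp: cone_def)

lemma linkpart_scal: "linkpart x (scal a c) = scal a (linkpart x c)"
  by (auto simp: linkpart_def scal_def)

lemma avoidpart_scal: "avoidpart x (scal a c) = scal a (avoidpart x c)"
  by (auto simp: avoidpart_def scal_def)

lemma scal_add_right: "scal a (b + c) = scal a b + scal a c"
  by (auto simp: scal_def algebra_simps)

lemma chains_add: "b \<in> chains F K k \<Longrightarrow> c \<in> chains F K k \<Longrightarrow> b + c \<in> chains F K k"
  by (auto simp: chains_def) (metis add.right_neutral)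

lemma chains_diff: "b \<in> chains F K k \<Longrightarrow> c \<in> chains F K k \<Longrightarrow> b - c \<in> chains F K k"
  by (auto simp: chains_def) (metis diff_zero)

lemma chains_minus: "c \<in> chains F K k \<Longrightarrow> - c \<in> chains F K k"
  by (auto simp: chains_def)

lemma chains_scal: "c \<in> chains F K k \<Longrightarrow> scal a c \<in> chains F K k"
  by (auto simp: chains_def scal_def)

lemma chains_0 [simp]: "0 \<in> chains F K k"
  by (auto simp: chains_def)

lemma chains_mono: "c \<in> chains F K k \<Longrightarrow> K \<subseteq> L \<Longrightarrow> c \<in> chains F L k"
  by (auto simp: chains_def faces_card_def)

lemma chains_restrict:
  "c \<in> chains F K k \<Longrightarrow> (\<And>\<sigma>. c \<sigma> \<noteq> 0 \<Longrightarrow> \<sigma> \<in> K \<Longrightarrow> card \<sigma> = k \<Longrightarrow> \<sigma> \<in> L) \<Longrightarrow> c \<in> chains F L k"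
  by (auto simp: chains_def faces_card_def)

lemma chains_nonzeroD: "c \<in> chains F K k \<Longrightarrow> c \<sigma> \<noteq> 0 \<Longrightarrow> \<sigma> \<in> K \<and> finite \<sigma> \<and> card \<sigma> = k"
  by (auto simp: chains_def faces_card_def)

lemma chains_eq_0: "c \<in> chains F K k \<Longrightarrow> (\<And>\<sigma>. \<sigma> \<in> K \<Longrightarrow> card \<sigma> \<noteq> k) \<Longrightarrow> c = 0"
  by (rule ext) (auto simp: chains_def faces_card_def)

lemma linkpart_chains:
  assumes "c \<in> chains F K (Suc k)"
  shows "linkpart x c \<in> chains F (link K {x}) k"
proof -
  { fix \<rho> assume "linkpart x c \<rho> \<noteq> 0"
    hence x: "x \<notin> \<rho>" "c (insert x \<rho>) \<noteq> 0" by (auto simp: linkpart_def split: if_splits)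
    with assms have "insert x \<rho> \<in> K" "finite \<rho>" "card (insert x \<rho>) = Suc k"
      by (auto dest: chains_nonzeroD)
    with x have "\<rho> \<in> link K {x}" "finite \<rho>" "card \<rho> = k"
      by (auto simp: link_def intro!: exI[of _ "insert x \<rho>"]) }
  thus ?thesis by (auto simp: chains_def faces_card_def)
qed

lemma linkpart_chains_0:
  assumes "c \<in> chains F K 0"
  shows "linkpart x c = 0"
  by (rule linkpart_eq_0) (use assms in \<open>force dest: chains_nonzeroD\<close>)

lemma avoidpart_chains:
  assumes "c \<in> chains F K k"
  shows "avoidpart x c \<in> chains F {\<sigma> \<in> K. x \<notin> \<sigma>} k"
  using assms by (auto simp: chains_def avoidpart_def faces_card_def)

lemma cone_chains:
  assumes "c \<in> chains F L k" "\<And>\<sigma>. \<sigma> \<in> L \<Longrightarrow> x \<notin> \<sigma> \<and> insert x \<sigma> \<in> K"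
  shows "cone x c \<in> chains F K (Suc k)"
proof -
  { fix \<sigma> assume "cone x c \<sigma> \<noteq> 0"
    hence x: "x \<in> \<sigma>" "c (\<sigma> - {x}) \<noteq> 0" by (auto simp: cone_def split: if_splits)
    from chains_nonzeroD[OF assms(1) x(2)] assms(2)[of "\<sigma> - {x}"] x(1)
    have "\<sigma> \<in> K" "finite \<sigma>" "card \<sigma> = Suc k"
      by (auto simp: insert_absorb intro: card.remove[THEN trans]) }
  thus ?thesis by (auto simp: chains_def faces_card_def)
qed

lemma unit_chain_chains: "\<sigma> \<in> K \<Longrightarrow> finite \<sigma> \<Longrightarrow> unit_chain \<sigma> \<in> chains F K (card \<sigma>)"
  by (auto simp: chains_def faces_card_def unit_chain_def)

section \<open>The boundary operator over a fixed finite vertex set\<close>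

locale ground =
  fixes U :: "'a::linorder set" and F :: "'k::field itself"
  assumes finite_ground: "finite U"
begin

text \<open>In contrast to \<open>bd\<close>, the complex is not a parameter: the sum runs over the
  vertices of \<open>U\<close> that can be added to \<open>\<tau>\<close>. A chain can thus be
  viewed in any subcomplex that contains its support, with the same boundary.\<close>

definition bdry :: "('a set \<Rightarrow> 'k) \<Rightarrow> 'a set \<Rightarrow> 'k" where
  "bdry c \<tau> = (\<Sum>y\<in>U - \<tau>. ins_sign y \<tau> * c (insert y \<tau>))"

definition carried :: "('a set \<Rightarrow> 'k) \<Rightarrow> bool" where
  "carried c \<longleftrightarrow> (\<forall>\<sigma>. c \<sigma> \<noteq> 0 \<longrightarrow> \<sigma> \<subseteq> U)"

definition cplx :: "'a set set \<Rightarrow> bool" where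
  "cplx K \<longleftrightarrow> simplicial_complex K \<and> K \<subseteq> Pow U"

text \<open>As in the definition of chains, \<open>k\<close> counts vertices, so \<open>exact_at K k\<close> says that the
  reduced homology of \<open>K\<close> vanishes in degree \<open>k - 1\<close>.\<close>

definition exact_at :: "'a set set \<Rightarrow> nat \<Rightarrow> bool" where
  "exact_at K k \<longleftrightarrow> (\<forall>c\<in>chains F K k. bdry c = 0 \<longrightarrow> (\<exists>b\<in>chains F K (Suc k). bdry b = c))"

text \<open>Stands for a top Betti number equal to one: if no face has more than \<open>n\<close>
  vertices, there are no nonzero boundaries of size \<open>n\<close>, and the homology at
  \<open>n\<close> is the space of cycles.\<close>

definition top_line :: "'a set set \<Rightarrow> nat \<Rightarrow> bool" where
  "top_line K n \<longleftrightarrow> (\<exists>z\<in>chains F K n. z \<noteq> 0 \<and> bdry z = 0 \<and>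
     (\<forall>c\<in>chains F K n. bdry c = 0 \<longrightarrow> (\<exists>a. c = scal a z)))"

lemma exact_atD:
  assumes "exact_at K k" "c \<in> chains F K k" "bdry c = 0"
  obtains b where "b \<in> chains F K (Suc k)" "bdry b = c"
  using assms by (auto simp: exact_at_def)

lemma bdry_add: "bdry (b + c) = bdry b + bdry c"
  by (rule ext) (simp add: bdry_def distrib_left sum.distrib)

lemma bdry_diff: "bdry (b - c) = bdry b - bdry c"
  by (rule ext) (simp add: bdry_def right_diff_distrib sum_subtractf)

lemma bdry_minus: "bdry (- c) = - bdry c"
  by (rule ext) (simp add: bdry_def sum_negf)

lemma bdry_scal: "bdry (scal a c) = scal a (bdry c)"
  by (rule ext) (simp add: bdry_def scal_def sum_distrib_left algebra_simps)

lemma bdry_0 [simp]: "bdry 0 = 0"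
  by (rule ext) (simp add: bdry_def)

lemma carried_chains: "c \<in> chains F K k \<Longrightarrow> K \<subseteq> Pow U \<Longrightarrow> carried c"
  by (auto simp: carried_def chains_def faces_card_def)

lemma bdry_outside: "carried c \<Longrightarrow> \<not> \<tau> \<subseteq> U \<Longrightarrow> bdry c \<tau> = 0"
  unfolding bdry_def by (rule sum.neutral) (auto simp: carried_def)

lemma bdry_bdry:
  assumes "carried c"
  shows "bdry (bdry c) = 0"
proof (rule ext)
  fix \<tau>
  show "bdry (bdry c) \<tau> = 0 \<tau>"
  proof (cases "\<tau> \<subseteq> U")
    case False
    have "carried (bdry c)" using bdry_outside[OF assms] by (auto simp: carried_def)
    with False show ?thesis by (simp add: bdry_outside)
  next
    case True
    hence ft: "finite \<tau>" using finite_ground finite_subset by blast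
    let ?V = "U - \<tau>"
    define t where "t y z = ins_sign y \<tau> * (ins_sign z (insert y \<tau>) * c (insert z (insert y \<tau>)))" for y z
    have fin: "finite ?V" using finite_ground by simp
    have anti: "t y z = - t z y" if "y \<in> ?V" "z \<in> ?V" "y \<noteq> z" for y z
    proof -
      have "ins_sign y \<tau> * ins_sign z (insert y \<tau>) = - (ins_sign z \<tau> * ins_sign y (insert z \<tau>) :: 'k)"
        using ins_sign_swap[OF ft, of y z] that by auto
      hence "(ins_sign y \<tau> * ins_sign z (insert y \<tau>)) * c (insert z (insert y \<tau>))
           = - (ins_sign z \<tau> * ins_sign y (insert z \<tau>)) * c (insert y (insert z \<tau>))"
        by (simp only: insert_commute)
      thus ?thesis unfolding t_def by (simp only: mult.assoc mult_minus_left)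
    qed
    have "bdry (bdry c) \<tau> = (\<Sum>y\<in>?V. \<Sum>z\<in>U - insert y \<tau>. t y z)"
      by (simp add: bdry_def t_def sum_distrib_left)
    \<comment> \<open>The terms are split by whether the second vertex is smaller or larger than the
      first; exchanging the sums and \<open>anti\<close> turn one half into the negative of the
      other.\<close>
    also have "\<dots> = (\<Sum>y\<in>?V. (\<Sum>z\<in>{z\<in>?V. z < y}. t y z) + (\<Sum>z\<in>{z\<in>?V. y < z}. t y z))"
    proof (rule sum.cong[OF refl])
      fix y assume "y \<in> ?V"
      have V: "U - insert y \<tau> = {z\<in>?V. z < y} \<union> {z\<in>?V. y < z}" by auto
      show "(\<Sum>z\<in>U - insert y \<tau>. t y z) = (\<Sum>z\<in>{z\<in>?V. z < y}. t y z) + (\<Sum>z\<in>{z\<in>?V. y < z}. t y z)"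
        unfolding V by (rule sum.union_disjoint) (use finite_ground in auto)
    qed
    also have "\<dots> = (\<Sum>y\<in>?V. \<Sum>z\<in>{z\<in>?V. z < y}. t y z) + (\<Sum>y\<in>?V. \<Sum>z\<in>{z\<in>?V. y < z}. t y z)"
      by (simp add: sum.distrib)
    also have "(\<Sum>y\<in>?V. \<Sum>z\<in>{z\<in>?V. y < z}. t y z) = (\<Sum>z\<in>?V. \<Sum>y\<in>{y\<in>?V. y < z}. t y z)"
      by (rule sum.swap_restrict[OF fin fin])
    also have "\<dots> = (\<Sum>z\<in>?V. \<Sum>y\<in>{y\<in>?V. y < z}. - t z y)"
      by (intro sum.cong[OF refl] anti) auto
    finally show ?thesis by (simp add: sum_negf)
  qed
qed

text \<open>Deleting \<open>x\<close> from a cone simplex returns its base, deleting any other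
  vertex gives a cone over a face of the base, and the minus sign is the cost of moving that vertex
  past \<open>x\<close>.\<close>

lemma bdry_cone:
  assumes "carried c" "x \<in> U" "\<And>\<sigma>. x \<in> \<sigma> \<Longrightarrow> c \<sigma> = 0"
  shows "bdry (cone x c) = c - cone x (bdry c)"
proof (rule ext)
  fix \<tau>
  show "bdry (cone x c) \<tau> = (c - cone x (bdry c)) \<tau>"
  proof (cases "x \<in> \<tau>")
    case False
    have "bdry (cone x c) \<tau> = (\<Sum>y\<in>U - \<tau>. if y = x then c \<tau> else 0)"
      unfolding bdry_def
    proof (rule sum.cong[OF refl])
      fix y assume "y \<in> U - \<tau>"
      thus "ins_sign y \<tau> * cone x c (insert y \<tau>) = (if y = x then c \<tau> else 0)"
        using False by (auto simp: cone_def)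
    qed
    also have "\<dots> = c \<tau>" using False assms(2) finite_ground by simp
    finally show ?thesis using False by (simp add: cone_def)
  next
    case True
    define \<rho> where "\<rho> = \<tau> - {x}"
    have \<tau>: "\<tau> = insert x \<rho>" "x \<notin> \<rho>" using True by (auto simp: \<rho>_def)
    show ?thesis
    proof (cases "\<tau> \<subseteq> U")
      case False
      have "bdry (cone x c) \<tau> = 0" unfolding bdry_def
      proof (rule sum.neutral, safe)
        fix y assume "y \<in> U" "y \<notin> \<tau>"
        have "\<not> (insert y \<tau> - {x}) \<subseteq> U" using False assms(2) by auto
        thus "ins_sign y \<tau> * cone x c (insert y \<tau>) = 0"
          using assms(1) by (auto simp: cone_def carried_def)
      qed
      moreover have "bdry c \<rho> = 0" using False \<tau> assms(2) by (intro bdry_outside[OF assms(1)]) auto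
      ultimately show ?thesis using \<tau> assms(3)[of \<tau>] by (simp add: cone_def)
    next
      case True
      hence "\<rho> \<subseteq> U" using \<tau> by auto
      hence ft: "finite \<rho>" using finite_ground finite_subset by blast
      have "bdry (cone x c) \<tau> = (\<Sum>y\<in>U - \<tau>. - (ins_sign x \<rho> * (ins_sign y \<rho> * c (insert y \<rho>))))"
        unfolding bdry_def
      proof (rule sum.cong[OF refl])
        fix y assume y: "y \<in> U - \<tau>"
        hence yx: "y \<noteq> x" "y \<notin> \<rho>" using \<tau> by auto
        have e: "insert y \<tau> - {x} = insert y \<rho>" using \<tau> yx by auto
        have "ins_sign x \<rho> * ins_sign y (insert x \<rho>) = - (ins_sign y \<rho> * ins_sign x (insert y \<rho>) :: 'k)"
          using ins_sign_swap[OF ft, of x y] yx \<tau> by auto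
        hence "ins_sign x \<rho> * (ins_sign x \<rho> * ins_sign y (insert x \<rho>)) * ins_sign x (insert y \<rho>)
             = - (ins_sign x \<rho> * (ins_sign y \<rho> * (ins_sign x (insert y \<rho>) * ins_sign x (insert y \<rho>))) :: 'k)"
          by (simp only: mult.assoc mult_minus_left mult_minus_right)
        hence "ins_sign y \<tau> * ins_sign x (insert y \<rho>) = - (ins_sign x \<rho> * ins_sign y \<rho> :: 'k)"
          using \<tau> by simp
        thus "ins_sign y \<tau> * cone x c (insert y \<tau>) = - (ins_sign x \<rho> * (ins_sign y \<rho> * c (insert y \<rho>)))"
          using \<tau> e by (simp add: cone_def flip: mult.assoc)
      qed
      also have "\<dots> = - (ins_sign x \<rho> * (\<Sum>y\<in>U - \<tau>. ins_sign y \<rho> * c (insert y \<rho>)))"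
        by (simp add: sum_negf sum_distrib_left)
      also have "(\<Sum>y\<in>U - \<tau>. ins_sign y \<rho> * c (insert y \<rho>)) = bdry c \<rho>"
        unfolding bdry_def using \<tau> assms(3) finite_ground
        by (intro sum.mono_neutral_left) auto
      finally show ?thesis using \<tau> assms(3)[of \<tau>] by (simp add: cone_def[of x "bdry c" "insert x \<rho>"])
    qed
  qed
qed

text \<open>Moving an added vertex past \<open>x\<close> costs a sign, so contraction by
  \<open>x\<close> anticommutes with the boundary. It carries cycles to cycles, and it turns a
  filling of \<open>c\<close> into a filling of \<open>- linkpart x c\<close>.\<close>

lemma linkpart_bdry:
  assumes "carried c"
  shows "linkpart x (bdry c) = - bdry (linkpart x c)"
proof (rule ext)
  fix \<rho>
  consider "x \<in> \<rho>" | "x \<notin> \<rho>" "\<not> insert x \<rho> \<subseteq> U" | "x \<notin> \<rho>" "insert x \<rho> \<subseteq> U" by blast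
  thus "linkpart x (bdry c) \<rho> = (- bdry (linkpart x c)) \<rho>"
  proof cases
    case 1
    thus ?thesis by (simp add: linkpart_def bdry_def)
  next
    case 2
    have "linkpart x c (insert y \<rho>) = 0" for y
    proof -
      have "\<not> insert x (insert y \<rho>) \<subseteq> U" using 2 by auto
      hence "c (insert x (insert y \<rho>)) = 0" using assms unfolding carried_def by blast
      thus ?thesis by (simp add: linkpart_def)
    qed
    moreover have "bdry c (insert x \<rho>) = 0" using bdry_outside assms 2 by blast
    ultimately show ?thesis by (simp add: linkpart_def bdry_def)
  next
    case 3
    hence "\<rho> \<subseteq> U" by auto
    hence ft: "finite \<rho>" using finite_ground finite_subset by blast
    have "(\<Sum>y\<in>U - \<rho>. ins_sign y \<rho> * linkpart x c (insert y \<rho>))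
        = (\<Sum>y\<in>U - insert x \<rho>. ins_sign y \<rho> * linkpart x c (insert y \<rho>))"
      using finite_ground by (intro sum.mono_neutral_right) (auto simp: linkpart_def)
    also have "\<dots> = (\<Sum>y\<in>U - insert x \<rho>. - (ins_sign x \<rho> * (ins_sign y (insert x \<rho>) * c (insert y (insert x \<rho>)))))"
    proof (rule sum.cong[OF refl])
      fix y assume y: "y \<in> U - insert x \<rho>"
      have "ins_sign x \<rho> * ins_sign y (insert x \<rho>) = - (ins_sign y \<rho> * ins_sign x (insert y \<rho>) :: 'k)"
        using ins_sign_swap[OF ft, of x y] y 3 by auto
      hence "ins_sign y \<rho> * (ins_sign x (insert y \<rho>) * c (insert x (insert y \<rho>)))
        = - (ins_sign x \<rho> * (ins_sign y (insert x \<rho>) * c (insert y (insert x \<rho>))))"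
        by (simp add: insert_commute flip: mult.assoc)
      thus "ins_sign y \<rho> * linkpart x c (insert y \<rho>) = - (ins_sign x \<rho> * (ins_sign y (insert x \<rho>) * c (insert y (insert x \<rho>))))"
        using y 3 by (auto simp: linkpart_def)
    qed
    finally show ?thesis using 3 by (simp add: linkpart_def bdry_def sum_negf sum_distrib_left)
  qed
qed

end

subsection \<open>Links and homology spheres\<close>

lemma mem_link: "\<rho> \<in> link K \<sigma> \<longleftrightarrow> \<rho> \<inter> \<sigma> = {} \<and> \<rho> \<union> \<sigma> \<in> K"
proof
  assume "\<rho> \<in> link K \<sigma>"
  then obtain \<tau> where "\<rho> = \<tau> - \<sigma>" "\<tau> \<in> K" "\<sigma> \<subseteq> \<tau>" by (auto simp: link_def)
  moreover from this have "\<rho> \<union> \<sigma> = \<tau>" by auto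
  ultimately show "\<rho> \<inter> \<sigma> = {} \<and> \<rho> \<union> \<sigma> \<in> K" by auto
next
  assume "\<rho> \<inter> \<sigma> = {} \<and> \<rho> \<union> \<sigma> \<in> K"
  moreover from this have "\<rho> = (\<rho> \<union> \<sigma>) - \<sigma>" by auto
  ultimately show "\<rho> \<in> link K \<sigma>" unfolding link_def by blast
qed

lemma link_empty [simp]: "link K {} = K"
  by (auto simp: mem_link)

lemma link_link: "\<sigma> \<inter> \<tau> = {} \<Longrightarrow> link (link K \<sigma>) \<tau> = link K (\<sigma> \<union> \<tau>)"
  by (auto simp: mem_link Un_ac)

lemma mem_induced: "\<alpha> \<in> induced K W \<longleftrightarrow> \<alpha> \<in> K \<and> \<alpha> \<subseteq> W"
  by (auto simp: induced_def)

context ground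
begin

lemma cplx_downward: "cplx K \<Longrightarrow> \<sigma> \<in> K \<Longrightarrow> \<tau> \<subseteq> \<sigma> \<Longrightarrow> \<tau> \<in> K"
  by (auto simp: cplx_def simplicial_complex_def)

lemma cplx_face: "cplx K \<Longrightarrow> \<sigma> \<in> K \<Longrightarrow> \<sigma> \<subseteq> U \<and> finite \<sigma>"
  using finite_ground by (auto simp: cplx_def intro: finite_subset)

lemma cplx_carried: "cplx K \<Longrightarrow> c \<in> chains F K k \<Longrightarrow> carried c"
  by (auto simp: cplx_def intro: carried_chains)

lemma cplxI:
  assumes "\<And>\<sigma>. \<sigma> \<in> K \<Longrightarrow> \<sigma> \<subseteq> U" "\<And>\<sigma> \<tau>. \<sigma> \<in> K \<Longrightarrow> \<tau> \<subseteq> \<sigma> \<Longrightarrow> \<tau> \<in> K"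
  shows "cplx K"
proof -
  have "K \<subseteq> Pow U" using assms(1) by auto
  moreover have "finite K" using calculation finite_ground finite_subset by blast
  ultimately show ?thesis using assms by (auto simp: cplx_def simplicial_complex_def)
qed

lemma cplx_link: "cplx K \<Longrightarrow> cplx (link K \<sigma>)"
  by (rule cplxI) (auto simp: mem_link dest: cplx_face elim!: cplx_downward)

lemma cplx_induced: "cplx K \<Longrightarrow> cplx (induced K W)"
  by (rule cplxI) (auto simp: mem_induced dest: cplx_face cplx_downward)

lemma cplx_Pow: "G \<subseteq> U \<Longrightarrow> cplx (Pow G)"
  by (rule cplxI) auto

lemma link_subset: "cplx K \<Longrightarrow> link K \<sigma> \<subseteq> K"
  by (auto simp: mem_link elim: cplx_downward)

lemma bdry_chains:
  assumes "cplx K" "c \<in> chains F K (Suc k)"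
  shows "bdry c \<in> chains F K k"
proof -
  { fix \<tau> assume "bdry c \<tau> \<noteq> 0"
    then obtain y where y: "y \<in> U - \<tau>" "c (insert y \<tau>) \<noteq> 0"
      unfolding bdry_def by (metis (no_types, lifting) mult_zero_right sum.neutral)
    from chains_nonzeroD[OF assms(2) y(2)] y(1) cplx_downward[OF assms(1), of "insert y \<tau>" \<tau>]
    have "\<tau> \<in> K \<and> finite \<tau> \<and> card \<tau> = k" by auto }
  thus ?thesis by (auto simp: chains_def faces_card_def)
qed

lemma bdry_chains_0:
  assumes "c \<in> chains F K 0"
  shows "bdry c = 0"
proof (rule ext)
  fix \<tau>
  have "c (insert y \<tau>) = 0" for y
    using chains_nonzeroD[OF assms, of "insert y \<tau>"] by (auto simp: card_eq_0_iff)
  thus "bdry c \<tau> = 0 \<tau>" by (simp add: bdry_def)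
qed

lemma bdry_bdry_chains: "cplx K \<Longrightarrow> c \<in> chains F K k \<Longrightarrow> bdry (bdry c) = 0"
  by (rule bdry_bdry) (rule cplx_carried)

lemma carried_linkpart: "carried c \<Longrightarrow> carried (linkpart x c)"
  by (auto simp: carried_def linkpart_def)

text \<open>If \<open>linkpart x c\<close> is a cycle, the last summand vanishes: removing the star
  of \<open>x\<close> leaves the boundary \<open>bdry c - linkpart x c\<close>. Adding any filling
  of the link part restores \<open>bdry c\<close>; later replacements of a star rest on
  this.\<close>

lemma bdry_avoidpart:
  assumes "carried c" "x \<in> U"
  shows "bdry (avoidpart x c) = bdry c - linkpart x c + cone x (bdry (linkpart x c))"
proof -
  have "bdry (cone x (linkpart x c)) = linkpart x c - cone x (bdry (linkpart x c))"
    by (rule bdry_cone) (auto simp: carried_linkpart assms, auto simp: linkpart_def)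
  moreover have "avoidpart x c = c - cone x (linkpart x c)"
    using avoidpart_plus_cone_linkpart[of x c] by (simp add: eq_diff_eq)
  ultimately show ?thesis by (simp add: bdry_diff)
qed

lemma bdry_linkpart_cycle:
  assumes "carried c" "linkpart x (bdry c) = 0"
  shows "bdry (linkpart x c) = 0"
  using linkpart_bdry[OF assms(1), of x] assms(2) by (metis neg_0_equal_iff_equal)

text \<open>The simplex is contracted to a vertex \<open>g\<close>. Only the part of
  \<open>c\<close> avoiding \<open>g\<close> is coned: the cycle condition makes its boundary minus
  the link part at \<open>g\<close>, so the cone has boundary exactly \<open>c\<close>.\<close>

lemma exact_at_Pow:
  assumes "G \<noteq> {}" "G \<subseteq> U"
  shows "exact_at (Pow G) k"
  unfolding exact_at_def
proof (intro ballI impI)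
  fix c assume c: "c \<in> chains F (Pow G) k" "bdry c = 0"
  obtain g where g: "g \<in> G" using assms by auto
  hence gU: "g \<in> U" using assms by auto
  have car: "carried c" using cplx_carried[OF cplx_Pow[OF assms(2)] c(1)] .
  let ?a = "avoidpart g c"
  have a: "?a \<in> chains F {\<sigma> \<in> Pow G. g \<notin> \<sigma>} k" by (rule avoidpart_chains[OF c(1)])
  have "bdry (linkpart g c) = 0" using c by (intro bdry_linkpart_cycle car) simp
  hence ba: "bdry ?a = - linkpart g c" using bdry_avoidpart[OF car gU] c by simp
  have "carried ?a" using car by (auto simp: carried_def avoidpart_def)
  hence "bdry (cone g ?a) = ?a - cone g (bdry ?a)"
    using gU by (intro bdry_cone) (auto simp: avoidpart_def)
  also have "\<dots> = c" by (simp add: ba cone_minus avoidpart_plus_cone_linkpart)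
  finally have "bdry (cone g ?a) = c" .
  moreover have "cone g ?a \<in> chains F (Pow G) (Suc k)" using g by (intro cone_chains[OF a]) auto
  ultimately show "\<exists>b\<in>chains F (Pow G) (Suc k). bdry b = c" by blast
qed

section \<open>Boundaries of single simplices and missing faces\<close>

lemma bdry_unit_chain_remove:
  assumes "\<sigma> \<subseteq> U" "x \<in> \<sigma>"
  shows "bdry (unit_chain \<sigma>) (\<sigma> - {x}) = ins_sign x (\<sigma> - {x})"
proof -
  have "bdry (unit_chain \<sigma>) (\<sigma> - {x}) = (\<Sum>y\<in>U - (\<sigma> - {x}). if y = x then ins_sign x (\<sigma> - {x}) else 0)"
    unfolding bdry_def
  proof (rule sum.cong[OF refl])
    fix y assume "y \<in> U - (\<sigma> - {x})"
    hence "insert y (\<sigma> - {x}) = \<sigma> \<longleftrightarrow> y = x" using assms by auto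
    thus "ins_sign y (\<sigma> - {x}) * unit_chain \<sigma> (insert y (\<sigma> - {x})) = (if y = x then ins_sign x (\<sigma> - {x}) else 0)"
      by (simp add: unit_chain_def)
  qed
  also have "\<dots> = ins_sign x (\<sigma> - {x})" using assms finite_ground by (simp add: subset_iff)
  finally show ?thesis .
qed

lemma bdry_unit_chain_nonzero:
  assumes "\<sigma> \<subseteq> U" "\<sigma> \<noteq> {}"
  shows "bdry (unit_chain \<sigma>) \<noteq> 0"
proof -
  obtain x where "x \<in> \<sigma>" using assms by auto
  hence "bdry (unit_chain \<sigma>) (\<sigma> - {x}) \<noteq> 0" using bdry_unit_chain_remove[OF assms(1)] by simp
  thus ?thesis by auto
qed

lemma bdry_unit_chain_singleton:
  assumes "x \<in> U"
  shows "bdry (unit_chain {x}) = unit_chain {}"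
proof -
  have "unit_chain {x} \<in> chains F (Pow {x}) (Suc 0)"
    using unit_chain_chains[of "{x}" "Pow {x}" F] by simp
  hence "bdry (unit_chain {x}) \<in> chains F (Pow {x}) 0"
    using assms by (intro bdry_chains cplx_Pow) auto
  hence "bdry (unit_chain {x}) \<tau> = 0" if "\<tau> \<noteq> {}" for \<tau>
    using that chains_nonzeroD[of "bdry (unit_chain {x})" F "Pow {x}" 0 \<tau>] by auto
  moreover have "bdry (unit_chain {x}) {} = 1"
    using bdry_unit_chain_remove[of "{x}" x] assms by (simp add: ins_sign_def)
  ultimately show ?thesis by (auto simp: unit_chain_def)
qed

lemma bdry_unit_chain_chains:
  assumes "\<sigma> \<subseteq> U" "card \<sigma> = Suc k"
  shows "bdry (unit_chain \<sigma>) \<in> chains F (Pow \<sigma> - {\<sigma>}) k"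
proof -
  have "unit_chain \<sigma> \<in> chains F (Pow \<sigma>) (Suc k)"
    using unit_chain_chains[of \<sigma> "Pow \<sigma>" F] assms by (simp add: card_ge_0_finite)
  hence "bdry (unit_chain \<sigma>) \<in> chains F (Pow \<sigma>) k" using assms by (intro bdry_chains cplx_Pow)
  thus ?thesis by (rule chains_restrict) (use assms in auto)
qed

lemma bdry_bdry_unit_chain: "\<sigma> \<subseteq> U \<Longrightarrow> bdry (bdry (unit_chain \<sigma>)) = 0"
  by (rule bdry_bdry) (auto simp: carried_def unit_chain_def split: if_splits)

text \<open>The boundary of the simplex \<open>\<sigma>\<close> is a cycle of the subcomplex induced
  on \<open>\<sigma>\<close>, and the only candidates for a filling are multiples of the absent
  \<open>\<sigma>\<close> itself.\<close>

lemma missing_face_not_exact: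
  assumes "\<sigma> \<subseteq> U" "\<sigma> \<notin> K" "\<And>\<tau>. \<tau> \<subset> \<sigma> \<Longrightarrow> \<tau> \<in> K" "card \<sigma> = Suc k"
  shows "\<not> exact_at (induced K \<sigma>) k"
proof
  assume ex: "exact_at (induced K \<sigma>) k"
  let ?c = "bdry (unit_chain \<sigma>)"
  have "?c \<in> chains F (induced K \<sigma>) k"
  proof (rule chains_mono[OF bdry_unit_chain_chains[OF assms(1,4)]], rule subsetI)
    fix \<tau> assume "\<tau> \<in> Pow \<sigma> - {\<sigma>}"
    hence "\<tau> \<subset> \<sigma>" by auto
    thus "\<tau> \<in> induced K \<sigma>" using assms(3) by (auto simp: mem_induced)
  qed
  from exact_atD[OF ex this bdry_bdry_unit_chain[OF assms(1)]]
  obtain b where b: "b \<in> chains F (induced K \<sigma>) (Suc k)" "bdry b = ?c" .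
  have "finite \<sigma>" using assms(4) by (simp add: card_ge_0_finite)
  hence "b = 0" using assms(2,4) by (intro chains_eq_0[OF b(1)]) (auto simp: mem_induced dest: card_subset_eq)
  moreover have "\<sigma> \<noteq> {}" using assms(4) by auto
  ultimately show False using b bdry_unit_chain_nonzero[OF assms(1)] by simp
qed

text \<open>Here \<open>n\<close> is the number of vertices of a facet: \<open>sph n\<close> describes homology spheres of
  dimension \<open>n - 1\<close>.\<close>

definition sph :: "nat \<Rightarrow> 'a set set \<Rightarrow> bool" where
  "sph n S \<longleftrightarrow> cplx S \<and> {} \<in> S \<and> (\<forall>\<sigma>\<in>S. card \<sigma> \<le> n \<and>
     (\<forall>k < n - card \<sigma>. exact_at (link S \<sigma>) k) \<and> top_line (link S \<sigma>) (n - card \<sigma>))"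

lemma sph_cplx: "sph n S \<Longrightarrow> cplx S"
  by (simp add: sph_def)

lemma sph_card: "sph n S \<Longrightarrow> \<sigma> \<in> S \<Longrightarrow> card \<sigma> \<le> n"
  by (simp add: sph_def)

lemma sph_exact: "sph n S \<Longrightarrow> k < n \<Longrightarrow> exact_at S k"
  unfolding sph_def by (metis card.empty diff_zero link_empty)

lemma sph_top: "sph n S \<Longrightarrow> top_line S n"
  unfolding sph_def by (metis card.empty diff_zero link_empty)

lemma sph_link:
  assumes "sph n S" "\<sigma> \<in> S"
  shows "sph (n - card \<sigma>) (link S \<sigma>)"
proof -
  have "card \<tau> \<le> n - card \<sigma> \<and> (\<forall>k < n - card \<sigma> - card \<tau>. exact_at (link (link S \<sigma>) \<tau>) k) \<and>
      top_line (link (link S \<sigma>) \<tau>) (n - card \<sigma> - card \<tau>)" if t: "\<tau> \<in> link S \<sigma>" for \<tau>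
  proof -
    from t have "\<sigma> \<inter> \<tau> = {}" "\<sigma> \<union> \<tau> \<in> S" by (auto simp: mem_link Un_ac)
    moreover have "card (\<sigma> \<union> \<tau>) = card \<sigma> + card \<tau>"
      using calculation cplx_face[OF sph_cplx[OF assms(1)]] by (intro card_Un_disjoint) auto
    ultimately show ?thesis using assms(1) unfolding sph_def
      by (metis add_le_imp_le_diff add.commute diff_diff_left link_link)
  qed
  moreover have "{} \<in> link S \<sigma>" using assms by (simp add: mem_link)
  ultimately show ?thesis using assms cplx_link[OF sph_cplx[OF assms(1)]] by (simp add: sph_def)
qed

text \<open>Purity: the link of \<open>\<sigma>\<close> carries a nonzero cycle in its top size, and
  any face in the support of that cycle completes \<open>\<sigma>\<close> to a facet.\<close>

lemma sph_facet:
  assumes "sph n S" "\<sigma> \<in> S"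
  obtains \<tau> where "\<tau> \<in> S" "\<sigma> \<subseteq> \<tau>" "card \<tau> = n"
proof -
  obtain z where z: "z \<in> chains F (link S \<sigma>) (n - card \<sigma>)" "z \<noteq> 0"
    using sph_top[OF sph_link[OF assms]] by (auto simp: top_line_def)
  then obtain \<rho> where "z \<rho> \<noteq> 0" by (auto simp: fun_eq_iff)
  hence \<rho>: "\<rho> \<in> link S \<sigma>" "finite \<rho>" "card \<rho> = n - card \<sigma>" using chains_nonzeroD[OF z(1)] by auto
  hence "card (\<rho> \<union> \<sigma>) = n"
    using sph_card[OF assms] cplx_face[OF sph_cplx[OF assms(1)] assms(2)] by (subst card_Un_disjoint) (auto simp: mem_link)
  with \<rho> show ?thesis by (intro that[of "\<rho> \<union> \<sigma>"]) (auto simp: mem_link)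
qed

text \<open>If \<open>q\<close> were outside \<open>A\<close>, the edges inside \<open>A\<close> of
  a filling of \<open>p - q\<close> would have boundary \<open>p\<close> alone, which contradicts
  the augmentation.\<close>

lemma exact_at_1_connected:
  assumes "cplx S" "exact_at S 1" "{p} \<in> S" "{q} \<in> S" "p \<in> A"
    and closed: "\<And>x y. x \<in> A \<Longrightarrow> {x, y} \<in> S \<Longrightarrow> y \<in> A"
  shows "q \<in> A"
proof (rule ccontr)
  assume q: "q \<notin> A"
  have U: "p \<in> U" "q \<in> U" using cplx_face[OF assms(1)] assms by auto
  have uc: "unit_chain {x} \<in> chains F S 1" if "{x} \<in> S" for x
    using unit_chain_chains[OF that, of F] by simp
  have "unit_chain {p} - unit_chain {q} \<in> chains F S 1" using assms by (intro chains_diff uc)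
  moreover have "bdry (unit_chain {p} - unit_chain {q}) = 0"
    using U by (simp add: bdry_diff bdry_unit_chain_singleton)
  ultimately obtain b where b: "b \<in> chains F S (Suc 1)" "bdry b = unit_chain {p} - unit_chain {q}"
    using exact_atD[OF assms(2)] by blast
  define b' where "b' \<sigma> = (if \<sigma> \<subseteq> A then b \<sigma> else 0)" for \<sigma>
  have b': "b' \<in> chains F S (Suc 1)" using b(1) by (auto simp: chains_def b'_def)
  have "bdry b' \<tau> = unit_chain {p} \<tau>" for \<tau>
  proof (cases "card \<tau> = 1")
    case False
    thus ?thesis using chains_nonzeroD[OF bdry_chains[OF assms(1) b'], of \<tau>] by (auto simp: unit_chain_def)
  next
    case True
    then obtain x where x: "\<tau> = {x}" by (auto simp: card_1_singleton_iff)
    show ?thesis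
    proof (cases "x \<in> A")
      case False
      thus ?thesis using x assms(5) by (auto simp: bdry_def b'_def unit_chain_def)
    next
      case True
      have "b' (insert y {x}) = b (insert y {x})" for y
        using True closed[of x y] chains_nonzeroD[OF b(1), of "{y,x}"] by (auto simp: b'_def insert_commute)
      hence "bdry b' \<tau> = bdry b \<tau>" by (simp add: bdry_def x)
      thus ?thesis using b(2) x True q by (auto simp: unit_chain_def)
    qed
  qed
  hence "bdry b' = unit_chain {p}" by auto
  hence "bdry (unit_chain {p}) = 0" using bdry_bdry_chains[OF assms(1) b'] by simp
  moreover have "unit_chain {} {} = (1::'k)" by (simp add: unit_chain_def)
  ultimately show False using bdry_unit_chain_singleton[OF U(1)] by (metis zero_fun_apply zero_neq_one)
qed

lemma linkpart_apply_remove: "x \<in> \<sigma> \<Longrightarrow> linkpart x c (\<sigma> - {x}) = ins_sign x (\<sigma> - {x}) * c \<sigma>"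
  by (simp add: linkpart_def insert_absorb)

text \<open>The vertices whose star misses the support of \<open>z\<close> are closed under
  adjacency: at a neighbour \<open>y\<close> of such a vertex, \<open>linkpart y z\<close> is zero
  on some facet of the link, hence zero by induction. By connectedness a single such vertex would
  make \<open>z\<close> vanish altogether.\<close>

lemma top_cycle_nonzero:
  assumes "sph n S" "z \<in> chains F S n" "bdry z = 0" "z \<noteq> 0" "\<sigma> \<in> S" "card \<sigma> = n"
  shows "z \<sigma> \<noteq> 0"
  using assms
proof (induction n arbitrary: S z \<sigma>)
  case 0
  obtain \<tau> where \<tau>: "z \<tau> \<noteq> 0" using 0 by (auto simp: fun_eq_iff)
  have "finite \<tau>" "card \<tau> = 0" using chains_nonzeroD[OF 0(2) \<tau>] by auto
  moreover have "finite \<sigma>" using cplx_face[OF sph_cplx] 0 by blast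
  ultimately show ?case using \<tau> 0 by auto
next
  case (Suc m)
  note cS = sph_cplx[OF Suc.prems(1)]
  note car = cplx_carried[OF cS Suc.prems(2)]
  have lk: "sph m (link S {p})" "linkpart p z \<in> chains F (link S {p}) m" "bdry (linkpart p z) = 0"
    if "{p} \<in> S" for p
  proof -
    show "sph m (link S {p})" using sph_link[OF Suc.prems(1) that] by simp
    show "linkpart p z \<in> chains F (link S {p}) m" by (rule linkpart_chains[OF Suc.prems(2)])
    show "bdry (linkpart p z) = 0"
      by (rule bdry_linkpart_cycle[OF car]) (simp only: Suc.prems(3) linkpart_0)
  qed
  define A where "A = {p. {p} \<in> S \<and> linkpart p z = 0}"
  have "p \<notin> A" for p
  proof
    assume p: "p \<in> A"
    hence pS: "{p} \<in> S" and pU: "p \<in> U" using cplx_face[OF cS] by (auto simp: A_def)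
    have zp: "z \<tau> = 0" if "p \<in> \<tau>" for \<tau>
      using linkpart_apply_remove[OF that, of z] p by (auto simp: A_def)
    have "q \<in> A" if q: "{q} \<in> S" for q
    proof (cases "m = 0")
      \<comment> \<open>In dimension zero there is no connectedness to use. Instead
        \<open>unit_chain {p} - unit_chain {q}\<close> is a cycle, so it and \<open>z\<close> are
        multiples of one generator, although only \<open>z\<close> vanishes at
        \<open>p\<close>.\<close>
      case True
      have qU: "q \<in> U" using cplx_face[OF cS q] by auto
      show ?thesis
      proof (rule ccontr)
        assume "q \<notin> A"
        hence pq: "p \<noteq> q" using p by auto
        have uc: "unit_chain {x} \<in> chains F S (Suc m)" if "{x} \<in> S" for x
          using unit_chain_chains[OF that, of F] True by simp
        obtain g where g: "\<forall>c\<in>chains F S (Suc m). bdry c = 0 \<longrightarrow> (\<exists>a. c = scal a g)"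
          using sph_top[OF Suc.prems(1)] by (auto simp: top_line_def)
        obtain a1 where a1: "z = scal a1 g" using g Suc.prems by blast
        have "bdry (unit_chain {p} - unit_chain {q}) = 0"
          using pU qU by (simp add: bdry_diff bdry_unit_chain_singleton)
        then obtain a2 where a2: "unit_chain {p} - unit_chain {q} = scal a2 g"
          using g chains_diff[OF uc[OF pS] uc[OF q]] by blast
        have "a1 \<noteq> 0" using a1 Suc.prems(4) by (auto simp: scal_def fun_eq_iff)
        hence "g {p} = 0" using zp[of "{p}"] a1 by (simp add: scal_def)
        moreover have "(unit_chain {p} - unit_chain {q}) {p} = (1::'k)" using pq by (simp add: unit_chain_def)
        ultimately show False using a2 by (simp add: scal_def)
      qed
    next
      case False
      show ?thesis
      proof (rule exact_at_1_connected[OF cS _ pS q p])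
        show "exact_at S 1" using False by (intro sph_exact[OF Suc.prems(1)]) simp
        fix x y assume x: "x \<in> A" and xy: "{x, y} \<in> S"
        have yS: "{y} \<in> S" by (rule cplx_downward[OF cS xy]) auto
        show "y \<in> A"
        proof (rule ccontr)
          assume y: "y \<notin> A"
          hence "x \<noteq> y" "linkpart y z \<noteq> 0" using x yS by (auto simp: A_def)
          hence "{x} \<in> link S {y}" using xy by (auto simp: mem_link insert_commute)
          then obtain \<tau> where \<tau>: "\<tau> \<in> link S {y}" "{x} \<subseteq> \<tau>" "card \<tau> = m"
            by (rule sph_facet[OF lk(1)[OF yS]])
          have "linkpart y z \<tau> \<noteq> 0" by (rule Suc.IH[OF lk[OF yS] \<open>linkpart y z \<noteq> 0\<close> \<tau>(1,3)])
          hence "z (insert y \<tau>) \<noteq> 0" by (auto simp: linkpart_def split: if_splits)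
          moreover have "z (insert y \<tau>) = 0"
            using linkpart_apply_remove[of x "insert y \<tau>" z] \<tau>(2) x by (auto simp: A_def)
          ultimately show False by simp
        qed
      qed
    qed
    moreover obtain \<tau> where \<tau>: "z \<tau> \<noteq> 0" using Suc.prems by (auto simp: fun_eq_iff)
    moreover from chains_nonzeroD[OF Suc.prems(2) \<tau>] obtain q where "q \<in> \<tau>" "{q} \<in> S"
      using cplx_downward[OF cS, of \<tau>] by (metis card_eq_SucD insertI1 empty_subsetI insert_subset)
    ultimately show False using linkpart_apply_remove[of q \<tau> z] by (auto simp: A_def)
  qed
  moreover obtain p where p: "p \<in> \<sigma>" using Suc.prems(6) by (metis card_eq_SucD insertI1)
  have pS: "{p} \<in> S" using p by (intro cplx_downward[OF cS Suc.prems(5)]) auto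
  ultimately have "linkpart p z \<noteq> 0" by (auto simp: A_def)
  moreover have "\<sigma> - {p} \<in> link S {p}" using p Suc.prems(5) by (auto simp: mem_link insert_absorb)
  moreover have "card (\<sigma> - {p}) = m" using p Suc.prems(6) by (simp add: card_Diff_singleton)
  ultimately have "linkpart p z (\<sigma> - {p}) \<noteq> 0" using Suc.IH[OF lk[OF pS]] by blast
  thus ?case using linkpart_apply_remove[OF p, of z] by auto
qed

text \<open>A case of Alexander duality: on the star of a vertex outside \<open>W\<close> any filling of \<open>c\<close> is a
  multiple of the fundamental cycle, with the same factor at adjacent vertices; subtracting that
  multiple moves the filling into \<open>W\<close>.\<close>

lemma top_duality:
  assumes S: "sph (Suc m) S" and c: "c \<in> chains F (induced S W) m" "bdry c = 0"
    and p0: "{p0} \<in> S" "p0 \<notin> W"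
    and clique: "\<And>p. {p} \<in> S \<Longrightarrow> p \<notin> W \<Longrightarrow> {p, p0} \<in> S"
  obtains b where "b \<in> chains F (induced S W) (Suc m)" "bdry b = c"
proof -
  note cS = sph_cplx[OF S]
  have "c \<in> chains F S m" by (rule chains_mono[OF c(1)]) (auto simp: mem_induced)
  then obtain b where b: "b \<in> chains F S (Suc m)" "bdry b = c"
    using exact_atD[OF sph_exact[OF S] _ c(2)] by blast
  obtain z where z: "z \<in> chains F S (Suc m)" "z \<noteq> 0" "bdry z = 0"
    using sph_top[OF S] by (auto simp: top_line_def)
  have proportional: "\<exists>a. \<forall>\<sigma>. p \<in> \<sigma> \<longrightarrow> b \<sigma> = a * z \<sigma>" if p: "{p} \<in> S" "p \<notin> W" for p
  proof -
    obtain g where g: "\<forall>c\<in>chains F (link S {p}) m. bdry c = 0 \<longrightarrow> (\<exists>a. c = scal a g)"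
      using sph_top[OF sph_link[OF S p(1)]] by (auto simp: top_line_def)
    have "linkpart p c = 0"
      by (rule linkpart_eq_0) (use chains_nonzeroD[OF c(1)] p in \<open>auto simp: mem_induced\<close>)
    hence "bdry (linkpart p b) = 0" "bdry (linkpart p z) = 0"
      using b z by (auto intro!: bdry_linkpart_cycle cplx_carried[OF cS])
    then obtain a1 a2 where a: "linkpart p b = scal a1 g" "linkpart p z = scal a2 g"
      using g linkpart_chains[OF b(1), of p] linkpart_chains[OF z(1), of p] by blast
    obtain \<tau> where \<tau>: "\<tau> \<in> S" "{p} \<subseteq> \<tau>" "card \<tau> = Suc m" by (rule sph_facet[OF S p(1)])
    have "z \<tau> \<noteq> 0" by (rule top_cycle_nonzero[OF S z(1,3,2) \<tau>(1,3)])
    hence "linkpart p z \<noteq> 0" using linkpart_apply_remove[of p \<tau> z] \<tau>(2) by auto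
    hence a2: "a2 \<noteq> 0" using a by (auto simp: scal_def)
    have "b \<sigma> = a1 / a2 * z \<sigma>" if "p \<in> \<sigma>" for \<sigma>
    proof -
      have "ins_sign p (\<sigma> - {p}) * b \<sigma> = a1 * g (\<sigma> - {p})"
        using linkpart_apply_remove[OF that, of b] a by (simp add: scal_def)
      moreover have "ins_sign p (\<sigma> - {p}) * z \<sigma> = a2 * g (\<sigma> - {p})"
        using linkpart_apply_remove[OF that, of z] a by (simp add: scal_def)
      ultimately have "ins_sign p (\<sigma> - {p}) * b \<sigma> = ins_sign p (\<sigma> - {p}) * (a1 / a2 * z \<sigma>)"
        using a2 by (simp add: field_simps)
      thus ?thesis by (subst (asm) mult_cancel_left) simp
    qed
    thus ?thesis by blast
  qed
  from proportional[OF p0] obtain a where a: "\<And>\<sigma>. p0 \<in> \<sigma> \<Longrightarrow> b \<sigma> = a * z \<sigma>" by blast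
  have eq: "b \<sigma> = a * z \<sigma>" if p: "{p} \<in> S" "p \<notin> W" "p \<in> \<sigma>" for p \<sigma>
  proof -
    from proportional[OF p(1,2)] obtain a' where a': "\<And>\<sigma>. p \<in> \<sigma> \<Longrightarrow> b \<sigma> = a' * z \<sigma>" by blast
    \<comment> \<open>The two factors agree because \<open>z\<close> is nonzero on a facet
      containing both \<open>p\<close> and \<open>p0\<close>.\<close>
    obtain \<tau> where \<tau>: "\<tau> \<in> S" "{p, p0} \<subseteq> \<tau>" "card \<tau> = Suc m" by (rule sph_facet[OF S clique[OF p(1,2)]])
    have "z \<tau> \<noteq> 0" by (rule top_cycle_nonzero[OF S z(1,3,2) \<tau>(1,3)])
    moreover have "a * z \<tau> = a' * z \<tau>" using a[of \<tau>] a'[of \<tau>] \<tau> by auto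
    ultimately show ?thesis using a'[OF p(3)] by simp
  qed
  have d: "b - scal a z \<in> chains F S (Suc m)" by (intro chains_diff chains_scal b z)
  have "b - scal a z \<in> chains F (induced S W) (Suc m)"
  proof (rule chains_restrict[OF d])
    fix \<sigma> assume \<sigma>: "(b - scal a z) \<sigma> \<noteq> 0" "\<sigma> \<in> S"
    have "p \<in> W" if "p \<in> \<sigma>" for p
    proof (rule ccontr)
      assume "p \<notin> W"
      moreover have "{p} \<in> S" using that by (intro cplx_downward[OF cS \<sigma>(2)]) auto
      ultimately have "b \<sigma> = a * z \<sigma>" using eq that by blast
      with \<sigma>(1) show False by (simp add: scal_def)
    qed
    thus "\<sigma> \<in> induced S W" using \<sigma> by (auto simp: mem_induced)
  qed
  moreover have "bdry (b - scal a z) = c" using b z by (simp add: bdry_diff bdry_scal)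
  ultimately show ?thesis by (rule that)
qed

end

subsection \<open>Simplicial vertices\<close>

text \<open>Dirac's argument: the vertices of the neighbourhood of \<open>u\<close> that border a component \<open>C\<close> of
  the non-neighbours form a clique, so a simplicial vertex of the smaller graph on \<open>C\<close> and this
  clique can be taken in \<open>C\<close>.\<close>

lemma simplicial_vertex_outside_neighbourhood:
  fixes adj :: "'v \<Rightarrow> 'v \<Rightarrow> bool"
  assumes "finite W" and sym: "\<And>x y. adj x y \<Longrightarrow> adj y x"
    and no_hole: "\<And>u x y Z. \<lbrakk>adj u x; adj u y; x \<noteq> y; \<not> adj x y;
        (\<lambda>a b. a \<in> Z \<and> b \<in> Z \<and> adj a b)\<^sup>*\<^sup>* x y;
        \<And>c. c \<in> Z \<Longrightarrow> c \<noteq> x \<Longrightarrow> c \<noteq> y \<Longrightarrow> c \<noteq> u \<and> \<not> adj u c\<rbrakk> \<Longrightarrow> False"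
    and "u \<in> W" "a \<in> W" "a \<noteq> u" "\<not> adj u a"
  shows "\<exists>w\<in>W. w \<noteq> u \<and> \<not> adj u w \<and> (\<forall>x\<in>W. \<forall>y\<in>W. adj w x \<longrightarrow> adj w y \<longrightarrow> x \<noteq> y \<longrightarrow> adj x y)"
  using assms(1,4-)
proof (induction W arbitrary: u a rule: finite_psubset_induct)
  case (psubset W)
  define Q where "Q = {c \<in> W. c \<noteq> u \<and> \<not> adj u c}"
  define R where "R = (\<lambda>p q. p \<in> Q \<and> q \<in> Q \<and> adj p q)"
  define C where "C = {c. R\<^sup>*\<^sup>* a c}"
  define N where "N = {x \<in> W. adj u x \<and> (\<exists>c\<in>C. adj x c)}"
  have aQ: "a \<in> Q" using psubset.prems by (auto simp: Q_def)
  have CQ: "C \<subseteq> Q"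
  proof
    fix c assume "c \<in> C"
    hence "R\<^sup>*\<^sup>* a c" by (simp add: C_def)
    thus "c \<in> Q" by (induction) (auto simp: aQ R_def)
  qed
  have aC: "a \<in> C" by (simp add: C_def)
  have Rsym: "R\<^sup>*\<^sup>* p q \<Longrightarrow> R\<^sup>*\<^sup>* q p" for p q
    by (rule sympD[OF symp_rtranclp]) (auto simp: R_def sym intro: sympI)
  have N_clique: "adj x y" if xy: "x \<in> N" "y \<in> N" "x \<noteq> y" for x y
  proof (rule ccontr)
    assume nadj: "\<not> adj x y"
    obtain c d where cd: "c \<in> C" "d \<in> C" "adj x c" "adj y d" using xy by (auto simp: N_def)
    define Z where "Z = C \<union> {x, y}"
    define T where "T = (\<lambda>a b. a \<in> Z \<and> b \<in> Z \<and> adj a b)"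
    have "R\<^sup>*\<^sup>* c d" using cd Rsym by (auto simp: C_def intro: rtranclp_trans)
    hence "T\<^sup>*\<^sup>* c d \<and> d \<in> C"
    proof (induction)
      case base
      show ?case using cd by simp
    next
      case (step p q)
      have "q \<in> C" using step.IH step.hyps(2) by (auto simp: C_def intro: rtranclp.rtrancl_into_rtrancl)
      moreover have "T p q" using step calculation by (auto simp: T_def R_def Z_def)
      ultimately show ?case using step by (auto intro: rtranclp.rtrancl_into_rtrancl)
    qed
    moreover have "T x c" "T d y" using cd sym by (auto simp: T_def Z_def)
    ultimately have "T\<^sup>*\<^sup>* x y" by (meson converse_rtranclp_into_rtranclp rtranclp.rtrancl_into_rtrancl)
    moreover have "adj u x" "adj u y" using xy by (auto simp: N_def)
    moreover have "c' \<noteq> u \<and> \<not> adj u c'" if "c' \<in> Z" "c' \<noteq> x" "c' \<noteq> y" for c'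
      using that CQ by (auto simp: Z_def Q_def)
    ultimately show False using no_hole[of u x y Z] nadj xy(3) unfolding T_def by blast
  qed
  let ?W = "C \<union> N"
  have "u \<notin> ?W" using CQ sym by (auto simp: Q_def N_def)
  hence sub: "?W \<subset> W" using CQ psubset.prems by (auto simp: Q_def N_def)
  \<comment> \<open>Vertices of \<open>C\<close> have no neighbours in \<open>W\<close> outside
    \<open>?W\<close>, so a vertex of \<open>C\<close> that is simplicial in \<open>?W\<close> is
    simplicial in \<open>W\<close>.\<close>
  have nb: "y \<in> ?W" if "c \<in> C" "adj c y" "y \<in> W" for c y
  proof (cases "adj u y")
    case True
    thus ?thesis using that sym by (auto simp: N_def)
  next
    case False
    have "y \<noteq> u" using that CQ sym by (auto simp: Q_def)
    hence "R c y" using that CQ False by (auto simp: Q_def R_def)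
    thus ?thesis using that(1) by (auto simp: C_def intro: rtranclp.rtrancl_into_rtrancl)
  qed
  have "\<exists>w\<in>C. \<forall>x\<in>?W. \<forall>y\<in>?W. adj w x \<longrightarrow> adj w y \<longrightarrow> x \<noteq> y \<longrightarrow> adj x y"
  \<comment> \<open>Such a \<open>u'\<close> is adjacent to all other vertices of \<open>N\<close>,
    so the simplicial vertex from the induction hypothesis, which differs from \<open>u'\<close> and
    is not adjacent to it, cannot lie in \<open>N\<close>. If there is no such \<open>u'\<close>,
    then \<open>?W\<close> is a clique: each vertex of \<open>N\<close> is adjacent to the rest of
    \<open>?W\<close>, and then so is every other vertex.\<close>
  proof (cases "\<exists>u'\<in>?W. (\<exists>a'\<in>?W. a' \<noteq> u' \<and> \<not> adj u' a') \<and> (\<forall>x\<in>N. x = u' \<or> adj u' x)")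
    case True
    then obtain u' a' where u': "u' \<in> ?W" "a' \<in> ?W" "a' \<noteq> u'" "\<not> adj u' a'" "\<forall>x\<in>N. x = u' \<or> adj u' x"
      by blast
    from psubset.IH[OF sub u'(1-4)] u'(5) show ?thesis by blast
  next
    case False
    hence all: "y = x \<or> adj x y" if "x \<in> ?W" "y \<in> ?W" "\<forall>w\<in>N. w = x \<or> adj x w" for x y
      using that by blast
    have NW: "y = x \<or> adj x y" if "x \<in> N" "y \<in> ?W" for x y
      using that N_clique[of x] by (intro all) auto
    have "y = x \<or> adj x y" if "x \<in> ?W" "y \<in> ?W" for x y
      using that NW sym by (intro all) blast+
    thus ?thesis using aC by blast
  qed
  then obtain w where w: "w \<in> C" "\<forall>x\<in>?W. \<forall>y\<in>?W. adj w x \<longrightarrow> adj w y \<longrightarrow> x \<noteq> y \<longrightarrow> adj x y" by blast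
  thus ?case using nb CQ by (intro bexI[of _ w]) (auto simp: Q_def)
qed

section \<open>From vanishing homology to simplicial vertices\<close>

context ground
begin

text \<open>The oriented edges along the walk telescope. An edge is written as the cone over its
  endpoint, so \<open>bdry_cone\<close> gives its boundary without comparing the two
  vertices.\<close>

lemma walk_chain:
  assumes "cplx S" "{x} \<in> S" "(\<lambda>a b. a \<in> Z \<and> b \<in> Z \<and> a \<noteq> b \<and> {a, b} \<in> S)\<^sup>*\<^sup>* x y"
  shows "\<exists>q \<in> chains F (induced S Z) 2. bdry q = unit_chain {y} - unit_chain {x}"
  using assms(3)
proof (induction)
  case base
  show ?case by (rule bexI[of _ 0]) (simp only: bdry_0 diff_self, rule chains_0)
next
  case (step a b)
  then obtain q where q: "q \<in> chains F (induced S Z) 2" "bdry q = unit_chain {a} - unit_chain {x}" by blast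
  have ab: "a \<in> Z" "b \<in> Z" "a \<noteq> b" "{a, b} \<in> S" using step by auto
  have U: "a \<in> U" "b \<in> U" using cplx_face[OF assms(1) ab(4)] by auto
  let ?e = "cone a (unit_chain {b})"
  have "unit_chain {b} \<in> chains F {{b}} (card {b})"
    by (rule unit_chain_chains) auto
  hence "?e \<in> chains F (induced S Z) (Suc (card {b}))"
    by (rule cone_chains) (use ab in \<open>auto simp: mem_induced\<close>)
  hence e: "?e \<in> chains F (induced S Z) 2" by (simp add: numeral_2_eq_2)
  have "cone a (unit_chain {}) = unit_chain {a}"
    by (rule ext) (auto simp: cone_def unit_chain_def ins_sign_def)
  hence "bdry ?e = unit_chain {b} - unit_chain {a}"
    using U ab by (subst bdry_cone) (auto simp: carried_def unit_chain_def bdry_unit_chain_singleton split: if_splits)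
  hence "bdry (q + ?e) = unit_chain {b} - unit_chain {x}" by (simp add: bdry_add q)
  thus ?case using chains_add[OF q(1) e] by blast
qed

text \<open>A filling of the cycle through \<open>u\<close> would have no triangle at \<open>u\<close>, although the
  cycle has edges there.\<close>

lemma no_hole:
  assumes cS: "cplx S" and ex: "\<And>W. exact_at (induced S W) 2"
    and ux: "{u, x} \<in> S" "u \<noteq> x" and uy: "{u, y} \<in> S" "u \<noteq> y" and xy: "x \<noteq> y" "{x, y} \<notin> S"
    and walk: "(\<lambda>a b. a \<in> Z \<and> b \<in> Z \<and> a \<noteq> b \<and> {a, b} \<in> S)\<^sup>*\<^sup>* x y"
    and Z: "\<And>c. c \<in> Z \<Longrightarrow> c \<noteq> x \<Longrightarrow> c \<noteq> y \<Longrightarrow> c \<noteq> u \<and> {u, c} \<notin> S"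
  shows False
proof -
  have S1: "{x} \<in> S" "{y} \<in> S" using cplx_downward[OF cS] ux uy by (metis insertI1 insertI2 empty_subsetI insert_subset)+
  have U: "u \<in> U" "x \<in> U" "y \<in> U" using cplx_face[OF cS] ux uy by auto
  let ?W = "insert u (insert x (insert y Z))"
  obtain q where q: "q \<in> chains F (induced S Z) 2" "bdry q = unit_chain {y} - unit_chain {x}"
    using walk_chain[OF cS S1(1) walk] by blast
  let ?d = "unit_chain {y} - unit_chain {x} :: 'a set \<Rightarrow> 'k"
  have "unit_chain {y} \<in> chains F {{x}, {y}} (card {y})" "unit_chain {x} \<in> chains F {{x}, {y}} (card {x})"
    by (rule unit_chain_chains; simp)+
  hence d: "?d \<in> chains F {{x}, {y}} 1" by (intro chains_diff) auto
  have p: "cone u ?d \<in> chains F (induced S ?W) 2"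
    using cone_chains[OF d, of u "induced S ?W"] ux uy by (auto simp: mem_induced numeral_2_eq_2)
  have du: "?d \<sigma> = 0" if "u \<in> \<sigma>" for \<sigma> using that ux uy by (auto simp: unit_chain_def)
  have "bdry (cone u ?d) = ?d - cone u (bdry ?d)"
    using U du by (intro bdry_cone) (auto simp: carried_def unit_chain_def split: if_splits)
  hence bp: "bdry (cone u ?d) = ?d" using U by (simp add: bdry_diff bdry_unit_chain_singleton)
  have "q \<in> chains F (induced S ?W) 2" by (rule chains_mono[OF q(1)]) (auto simp: mem_induced)
  \<comment> \<open>The closed curve is the path from \<open>x\<close> over \<open>u\<close> to
    \<open>y\<close>, written as a cone over \<open>y - x\<close>, minus the chain \<open>q\<close>
    of the walk.\<close>
  hence "cone u ?d - q \<in> chains F (induced S ?W) 2" using p by (intro chains_diff)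
  moreover have "bdry (cone u ?d - q) = 0" using bp q by (simp add: bdry_diff)
  ultimately obtain b where b: "b \<in> chains F (induced S ?W) (Suc 2)" "bdry b = cone u ?d - q"
    using exact_atD[OF ex] by blast
  have "linkpart u b = 0"
  proof (rule linkpart_eq_0, rule ccontr)
    fix \<sigma> assume \<sigma>: "u \<in> \<sigma>" "b \<sigma> \<noteq> 0"
    from chains_nonzeroD[OF b(1) \<sigma>(2)] have s: "\<sigma> \<in> S" "\<sigma> \<subseteq> ?W" "finite \<sigma>" "card \<sigma> = 3" by (auto simp: mem_induced)
    have "c \<in> {u, x, y}" if "c \<in> \<sigma>" for c
    proof -
      have "{u, c} \<in> S" using that \<sigma>(1) by (intro cplx_downward[OF cS s(1)]) auto
      thus ?thesis using Z[of c] s(2) that by auto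
    qed
    hence "\<sigma> \<subseteq> {u, x, y}" by auto
    moreover have "card {u, x, y} = 3" using ux uy xy by simp
    ultimately have "\<sigma> = {u, x, y}" using s(4) by (intro card_subset_eq) auto
    hence "{x, y} \<in> S" by (intro cplx_downward[OF cS s(1)]) auto
    thus False using xy by simp
  qed
  moreover have "carried b" by (rule cplx_carried[OF cplx_induced[OF cS] b(1)])
  ultimately have "linkpart u (cone u ?d - q) = 0" using linkpart_bdry[of b u] b(2) by simp
  moreover have "linkpart u q = 0"
    by (rule linkpart_eq_0) (use chains_nonzeroD[OF q(1)] Z ux uy in \<open>auto simp: mem_induced\<close>)
  ultimately have "?d = 0" using linkpart_cone[of u ?d] du by (simp add: linkpart_diff)
  moreover have "?d {y} = 1" using xy by (simp add: unit_chain_def)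
  ultimately show False by (metis zero_fun_apply zero_neq_one)
qed

lemma simplicial_vertex_exists:
  assumes cS: "cplx S" and ex: "\<And>W. exact_at (induced S W) 2" and "{u0} \<in> S"
  obtains v where "{v} \<in> S"
    "\<And>x y. {v, x} \<in> S \<Longrightarrow> {v, y} \<in> S \<Longrightarrow> {x, y} \<in> S"
proof -
  define adj where "adj x y \<longleftrightarrow> x \<noteq> y \<and> {x, y} \<in> S" for x y
  define V where "V = {v. {v} \<in> S}"
  have edge: "{x} \<in> S" "{y} \<in> S" if "{x, y} \<in> S" for x y
    using cplx_downward[OF cS that] by auto
  have fin: "finite V"
    by (rule finite_subset[OF _ finite_ground]) (auto simp: V_def dest: cplx_face[OF cS])
  have sym: "adj x y \<Longrightarrow> adj y x" for x y by (auto simp: adj_def insert_commute)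
  have hole: False if "adj u x" "adj u y" "x \<noteq> y" "\<not> adj x y"
    "(\<lambda>a b. a \<in> Z \<and> b \<in> Z \<and> adj a b)\<^sup>*\<^sup>* x y"
    "\<And>c. c \<in> Z \<Longrightarrow> c \<noteq> x \<Longrightarrow> c \<noteq> y \<Longrightarrow> c \<noteq> u \<and> \<not> adj u c" for u x y Z
    by (rule no_hole[OF cS ex, of u x y Z]) (use that in \<open>auto simp: adj_def\<close>)
  have "\<exists>w\<in>V. \<forall>x\<in>V. \<forall>y\<in>V. adj w x \<longrightarrow> adj w y \<longrightarrow> x \<noteq> y \<longrightarrow> adj x y"
  proof (cases "\<exists>u\<in>V. \<exists>a\<in>V. a \<noteq> u \<and> \<not> adj u a")
    case True
    then obtain u a where ua: "u \<in> V" "a \<in> V" "a \<noteq> u" "\<not> adj u a" by blast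
    have "\<exists>w\<in>V. w \<noteq> u \<and> \<not> adj u w \<and> (\<forall>x\<in>V. \<forall>y\<in>V. adj w x \<longrightarrow> adj w y \<longrightarrow> x \<noteq> y \<longrightarrow> adj x y)"
    proof (rule simplicial_vertex_outside_neighbourhood[where a = a, OF fin])
      show "adj x y \<Longrightarrow> adj y x" for x y by (rule sym)
      fix u x y Z
      assume "adj u x" "adj u y" "x \<noteq> y" "\<not> adj x y" "(\<lambda>a b. a \<in> Z \<and> b \<in> Z \<and> adj a b)\<^sup>*\<^sup>* x y"
        "\<And>c. c \<in> Z \<Longrightarrow> c \<noteq> x \<Longrightarrow> c \<noteq> y \<Longrightarrow> c \<noteq> u \<and> \<not> adj u c"
      thus False by (rule hole)
    qed (use ua in auto)
    thus ?thesis by blast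
  next
    case False
    thus ?thesis using assms(3) by (intro bexI[of _ u0]) (auto simp: V_def)
  qed
  then obtain v where v: "v \<in> V" "\<forall>x\<in>V. \<forall>y\<in>V. adj v x \<longrightarrow> adj v y \<longrightarrow> x \<noteq> y \<longrightarrow> adj x y" by blast
  show ?thesis
  proof (rule that[of v])
    show "{v} \<in> S" using v by (simp add: V_def)
    fix x y assume vx: "{v, x} \<in> S" and vy: "{v, y} \<in> S"
    have xy: "x \<in> V" "y \<in> V" using edge[OF vx] edge[OF vy] by (simp_all add: V_def)
    consider "v = x" | "v = y" | "x = y" | "v \<noteq> x" "v \<noteq> y" "x \<noteq> y" by blast
    thus "{x, y} \<in> S"
    proof cases
      case 1
      thus ?thesis using vy by simp
    next
      case 2
      thus ?thesis using vx by (simp add: insert_commute)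
    next
      case 3
      thus ?thesis using xy by (simp add: V_def)
    next
      case 4
      thus ?thesis using v(2) xy vx vy by (simp add: adj_def)
    qed
  qed
qed

definition hollow :: "nat \<Rightarrow> 'a set set \<Rightarrow> bool" where
  "hollow n S \<longleftrightarrow> (\<forall>W k. 2 \<le> k \<and> k + 2 \<le> n \<longrightarrow> exact_at (induced S W) k)"

text \<open>A missing face with \<open>k + 1\<close> vertices gives a homology class at size
  \<open>k\<close> of the subcomplex induced on it; its possible sizes \<open>3\<close> to
  \<open>n - 1\<close> match the range \<open>2 \<le> k \<le> n - 2\<close> of
  \<open>hollow\<close>.\<close>

lemma hollow_face:
  assumes "hollow n S" "cplx S" "\<sigma> \<subseteq> U" "3 \<le> card \<sigma>" "card \<sigma> < n" "\<And>x. x \<in> \<sigma> \<Longrightarrow> \<sigma> - {x} \<in> S"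
  shows "\<sigma> \<in> S"
proof (rule ccontr)
  assume "\<sigma> \<notin> S"
  moreover have "\<tau> \<in> S" if \<tau>: "\<tau> \<subset> \<sigma>" for \<tau>
  proof -
    obtain x where x: "x \<in> \<sigma>" "x \<notin> \<tau>" using \<tau> by auto
    show ?thesis by (rule cplx_downward[OF assms(2) assms(6)[OF x(1)]]) (use \<tau> x in auto)
  qed
  moreover obtain k where "card \<sigma> = Suc k" using assms(4) by (cases "card \<sigma>") auto
  ultimately have "\<not> exact_at (induced S \<sigma>) k" using missing_face_not_exact[OF assms(3)] by blast
  thus False using assms(1,4,5) \<open>card \<sigma> = Suc k\<close> by (auto simp: hollow_def)
qed

text \<open>Let \<open>T\<close> be the link and \<open>G\<close> its vertex set. Sets with at most
  \<open>n - 2\<close> elements are faces of \<open>T\<close> by \<open>hollow_face\<close>, applied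
  to \<open>M\<close> and to \<open>insert v M\<close>; those with \<open>n - 1\<close> elements are
  faces by duality. The fundamental cycle of \<open>T\<close> then leaves \<open>n\<close> as the
  only possible number of vertices.\<close>

lemma simplicial_vertex_link:
  assumes S: "sph n S" and n: "4 \<le> n" and H: "hollow n S" and v: "{v} \<in> S"
    and simp: "\<And>x y. {v, x} \<in> S \<Longrightarrow> {v, y} \<in> S \<Longrightarrow> {x, y} \<in> S"
  obtains G where "card G = n" "link S {v} = Pow G - {G}" "v \<notin> G" "G \<subseteq> U"
proof -
  note cS = sph_cplx[OF S]
  define T where "T = link S {v}"
  define G where "G = {x. {x} \<in> T}"
  obtain m where m: "n = Suc (Suc m)" "2 \<le> m" by (rule that[of "n - 2"]) (use n in auto)
  have T: "sph (Suc m) T" using sph_link[OF S v] m by (simp add: T_def)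
  note cT = sph_cplx[OF T]
  have TG: "\<tau> \<subseteq> G" if "\<tau> \<in> T" for \<tau> using cplx_downward[OF cT that] by (auto simp: G_def)
  have GU: "G \<subseteq> U" using cplx_face[OF cT] by (auto simp: G_def)
  have finG: "finite G" using GU finite_ground finite_subset by blast
  have vG: "v \<notin> G" by (auto simp: G_def T_def mem_link)
  have Gx: "{v, x} \<in> S" if "x \<in> G" for x using that by (auto simp: G_def T_def mem_link insert_commute)
  have small: "M \<subseteq> G \<Longrightarrow> card M \<le> m \<Longrightarrow> M \<in> T" for M
  proof (induction "card M" arbitrary: M rule: less_induct)
    case less
    have fM: "finite M" using less.prems finG finite_subset by blast
    consider "card M = 0" | "card M = 1" | "2 \<le> card M" by linarith
    thus ?case
    proof cases
      case 1
      thus ?thesis using fM T by (auto simp: sph_def)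
    next
      case 2
      thus ?thesis using less.prems by (auto simp: card_1_singleton_iff G_def)
    next
      case 3
      have sub: "M - {x} \<in> T" if "x \<in> M" for x
        using that fM less.prems card_Diff1_less[OF fM that] by (intro less.hyps) auto
      have "M \<in> S"
      \<comment> \<open>Pairs are out of reach of \<open>hollow_face\<close>; here the simpliciality
        of \<open>v\<close> enters.\<close>
      proof (cases "card M = 2")
        case True
        then obtain x y where "M = {x, y}" by (auto simp: card_2_iff)
        moreover from this have "x \<in> G" "y \<in> G" using less.prems by auto
        ultimately show ?thesis using simp[OF Gx Gx] by blast
      next
        case False
        show ?thesis
        proof (rule hollow_face[OF H cS])
          show "M \<subseteq> U" using less.prems GU by blast
          show "3 \<le> card M" "card M < n" using False 3 less.prems m by simp_all
          show "M - {x} \<in> S" if "x \<in> M" for x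
            using sub[OF that] link_subset[OF cS] by (auto simp: T_def)
        qed
      qed
      have "insert v M \<in> S"
      proof (rule hollow_face[OF H cS])
        show "insert v M \<subseteq> U" using less.prems GU v cplx_face[OF cS v] by auto
        have "v \<notin> M" using vG less.prems by auto
        thus "3 \<le> card (insert v M)" "card (insert v M) < n" using 3 fM less.prems m by auto
        fix x assume "x \<in> insert v M"
        thus "insert v M - {x} \<in> S"
        proof (cases "x = v")
          case True
          thus ?thesis using \<open>v \<notin> M\<close> \<open>M \<in> S\<close> by simp
        next
          case False
          hence "M - {x} \<in> T" using \<open>x \<in> insert v M\<close> by (intro sub) simp
          thus ?thesis using False by (simp add: T_def mem_link insert_Diff_if)
        qed
      qed
      thus ?thesis using vG less.prems by (auto simp: T_def mem_link)
    qed
  qed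
  \<comment> \<open>Adding \<open>v\<close> would give \<open>n\<close> vertices, beyond the range
    of \<open>hollow_face\<close>. Instead \<open>top_duality\<close> fills the boundary of a
    missing \<open>M\<close> inside the subcomplex induced on \<open>M\<close>, which has no face of
    that size. This needs a vertex \<open>p0\<close> outside \<open>M\<close>; for
    \<open>M = G\<close> any facet of \<open>T\<close> is already \<open>M\<close>.\<close>
  have big: "M \<in> T" if M: "M \<subseteq> G" "card M = Suc m" for M
  proof (rule ccontr)
    assume nM: "M \<notin> T"
    show False
    proof (cases "M = G")
      case True
      have "{} \<in> T" using T by (simp add: sph_def)
      then obtain \<tau> where "\<tau> \<in> T" "card \<tau> = Suc m" by (rule sph_facet[OF T])
      thus False using TG[of \<tau>] True nM M finG card_subset_eq[of G \<tau>] by auto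
    next
      case False
      then obtain p0 where p0: "p0 \<in> G" "p0 \<notin> M" using M by blast
      have MU: "M \<subseteq> U" using M GU by auto
      have fM: "finite M" using M finG finite_subset by blast
      have ch: "bdry (unit_chain M) \<in> chains F (induced T M) m"
      proof (rule chains_restrict[OF bdry_unit_chain_chains[OF MU M(2)]])
        fix \<sigma> assume "\<sigma> \<in> Pow M - {M}" "card \<sigma> = m"
        thus "\<sigma> \<in> induced T M" using small[of \<sigma>] M by (auto simp: mem_induced)
      qed
      obtain b where b: "b \<in> chains F (induced T M) (Suc m)" "bdry b = bdry (unit_chain M)"
      proof (rule top_duality[OF T ch bdry_bdry_unit_chain[OF MU], of p0])
        show "{p0} \<in> T" using p0 by (simp add: G_def)
        show "p0 \<notin> M" by (rule p0)
        fix p assume "{p} \<in> T"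
        thus "{p, p0} \<in> T" using p0 m by (intro small) (auto simp: G_def card_insert_if)
      qed
      have "b = 0"
      proof (rule chains_eq_0[OF b(1)])
        fix \<sigma> assume "\<sigma> \<in> induced T M"
        thus "card \<sigma> \<noteq> Suc m" using nM M card_subset_eq[OF fM, of \<sigma>] by (auto simp: mem_induced)
      qed
      moreover have "M \<noteq> {}" using M by auto
      ultimately show False using b bdry_unit_chain_nonzero[OF MU] by simp
    qed
  qed
  obtain z where z: "z \<in> chains F T (Suc m)" "z \<noteq> 0" "bdry z = 0"
    using sph_top[OF T] by (auto simp: top_line_def)
  \<comment> \<open>With fewer than \<open>n\<close> vertices the only possible facet is
    \<open>G\<close> itself, and a nonzero multiple of a single simplex is not a cycle.\<close>
  have "card G \<ge> n"
  proof (rule ccontr)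
    assume less: "\<not> card G \<ge> n"
    have G\<sigma>: "\<sigma> = G" if "z \<sigma> \<noteq> 0" for \<sigma>
    proof -
      have \<sigma>: "\<sigma> \<subseteq> G" "card \<sigma> = Suc m" using chains_nonzeroD[OF z(1) that] TG by auto
      moreover have "card \<sigma> \<le> card G" using \<sigma> finG by (intro card_mono)
      ultimately show ?thesis using less m finG by (intro card_subset_eq) auto
    qed
    have "z = scal (z G) (unit_chain G)"
      by (rule ext) (use G\<sigma> in \<open>auto simp: scal_def unit_chain_def\<close>)
    hence "scal (z G) (bdry (unit_chain G)) = 0" using z(3) bdry_scal by metis
    hence eq: "z G * bdry (unit_chain G) \<tau> = 0" for \<tau> by (metis scal_def zero_fun_apply)
    have zG: "z G \<noteq> 0" using G\<sigma> z(2) by (auto simp: fun_eq_iff)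
    hence "bdry (unit_chain G) = 0" using eq by (intro ext) simp
    moreover have "G \<noteq> {}" using chains_nonzeroD[OF z(1) zG] by auto
    ultimately show False using bdry_unit_chain_nonzero[OF GU] by simp
  qed
  \<comment> \<open>With more vertices, the boundary of a simplex on \<open>n\<close> of them is a
    nonzero top cycle of \<open>T\<close>. It would have to be nonzero on every facet, including one
    through a vertex \<open>p\<close> outside that simplex.\<close>
  moreover have "card G \<le> n"
  proof (rule ccontr)
    assume gt: "\<not> card G \<le> n"
    obtain W where W: "W \<subseteq> G" "card W = n" "finite W"
      using obtain_subset_with_card_n[of n G] gt by auto
    have WU: "W \<subseteq> U" using W GU by auto
    have ch: "bdry (unit_chain W) \<in> chains F T (Suc m)"
    proof (rule chains_restrict[OF bdry_unit_chain_chains[OF WU]])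
      show "card W = Suc (Suc m)" using W m by simp
      fix \<sigma> assume "\<sigma> \<in> Pow W - {W}" "card \<sigma> = Suc m"
      thus "\<sigma> \<in> T" using W by (intro big) auto
    qed
    have "W \<noteq> G" using gt W by auto
    then obtain p where p: "p \<in> G" "p \<notin> W" using W by auto
    obtain M0 where M0: "M0 \<subseteq> W" "card M0 = m" "finite M0"
      using obtain_subset_with_card_n[of m W] W m by auto
    have M: "insert p M0 \<in> T" "card (insert p M0) = Suc m"
    proof -
      show "card (insert p M0) = Suc m" using M0 p by (subst card_insert_disjoint) auto
      thus "insert p M0 \<in> T" using M0 p W by (intro big) auto
    qed
    have "W \<noteq> {}" using W m by auto
    hence "bdry (unit_chain W) (insert p M0) \<noteq> 0"
      by (intro top_cycle_nonzero[OF T ch bdry_bdry_unit_chain[OF WU] _ M] bdry_unit_chain_nonzero[OF WU])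
    moreover have "insert p M0 \<notin> Pow W - {W}" using p by auto
    moreover have "bdry (unit_chain W) \<in> chains F (Pow W - {W}) (Suc m)"
      using W m by (intro bdry_unit_chain_chains[OF WU]) simp
    ultimately show False by (auto dest: chains_nonzeroD)
  qed
  ultimately have card: "card G = n" by simp
  have "T = Pow G - {G}"
  proof
    have "G \<notin> T" using sph_card[OF T, of G] card m by auto
    thus "T \<subseteq> Pow G - {G}" using TG by auto
    show "Pow G - {G} \<subseteq> T"
    proof
      fix \<tau> assume "\<tau> \<in> Pow G - {G}"
      hence "\<tau> \<subset> G" by auto
      moreover from this have "card \<tau> < n" using psubset_card_mono[OF finG] card by auto
      moreover from this have "card \<tau> \<le> m \<or> card \<tau> = Suc m" using m by linarith
      ultimately show "\<tau> \<in> T" using small big by blast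
    qed
  qed
  hence "link S {v} = Pow G - {G}" by (simp only: T_def)
  thus ?thesis by (rule that[OF card _ vG GU])
qed

end

subsection \<open>Removing a simplicial vertex\<close>

text \<open>When the link of \<open>v\<close> is the boundary of \<open>G\<close>, this undoes the
  stellar subdivision of the facet \<open>G\<close> at \<open>v\<close>.\<close>

definition cap_off :: "'a \<Rightarrow> 'a set \<Rightarrow> 'a set set \<Rightarrow> 'a set set" where
  "cap_off v G L = {\<tau> \<in> L. v \<notin> \<tau>} \<union> {G}"

context ground
begin

text \<open>The complex \<open>L\<close> is kept general because the construction is localized: it
  is applied to links of faces \<open>\<sigma>\<close> of a sphere, with \<open>G - \<sigma>\<close>
  in place of \<open>G\<close>, and to induced subcomplexes. The condition on
  \<open>insert v \<tau>\<close> says that the link of \<open>v\<close> in \<open>L\<close> is the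
  boundary of \<open>G\<close>.\<close>

context
  fixes L :: "'a set set" and v :: 'a and G :: "'a set"
  assumes cL: "cplx L" and vU: "v \<in> U" and GU: "G \<subseteq> U" and vG: "v \<notin> G" and GL: "G \<notin> L"
    and star: "\<And>\<tau>. v \<notin> \<tau> \<Longrightarrow> insert v \<tau> \<in> L \<longleftrightarrow> \<tau> \<subset> G"
    and G0: "G \<noteq> {}"
begin

lemma cap_off_Pow: "Pow G \<subseteq> cap_off v G L"
proof
  fix \<tau> assume "\<tau> \<in> Pow G"
  moreover have "\<tau> \<in> L" if "\<tau> \<subset> G"
  proof -
    have "insert v \<tau> \<in> L" using star[of \<tau>] that vG by auto
    thus ?thesis by (rule cplx_downward[OF cL]) auto
  qed
  ultimately show "\<tau> \<in> cap_off v G L" using vG by (auto simp: cap_off_def)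
qed

lemma cap_off_cplx: "cplx (cap_off v G L)"
proof (rule cplxI)
  fix \<sigma> \<tau> assume s: "\<sigma> \<in> cap_off v G L" "\<tau> \<subseteq> \<sigma>"
  show "\<tau> \<in> cap_off v G L"
  proof (cases "\<sigma> = G")
    case True
    thus ?thesis using cap_off_Pow s by auto
  next
    case False
    thus ?thesis using s cplx_downward[OF cL, of \<sigma> \<tau>] by (auto simp: cap_off_def)
  qed
qed (use GU cplx_face[OF cL] in \<open>auto simp: cap_off_def\<close>)

lemma link_chain_Pow: "c \<in> chains F L (Suc k) \<Longrightarrow> linkpart v c \<in> chains F (Pow G) k"
proof (rule chains_mono[OF linkpart_chains], assumption, rule subsetI)
  fix \<tau> assume "\<tau> \<in> link L {v}"
  thus "\<tau> \<in> Pow G" using star[of \<tau>] by (auto simp: mem_link)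
qed

text \<open>A filling in \<open>L\<close> is pushed off \<open>v\<close> by replacing its star at \<open>v\<close> with a chain in the
  simplex \<open>G\<close>.\<close>

lemma cap_off_exact:
  assumes "exact_at L k" "k < card G"
  shows "exact_at (cap_off v G L) k"
  unfolding exact_at_def
proof (intro ballI impI)
  fix c assume c: "c \<in> chains F (cap_off v G L) k" "bdry c = 0"
  \<comment> \<open>Since \<open>k < card G\<close>, the new face \<open>G\<close> does not occur in
    \<open>c\<close>.\<close>
  have "c \<in> chains F L k"
    by (rule chains_restrict[OF c(1)]) (use assms(2) in \<open>auto simp: cap_off_def\<close>)
  then obtain b where b: "b \<in> chains F L (Suc k)" "bdry b = c"
    using exact_atD[OF assms(1) _ c(2)] by blast
  have car: "carried b" by (rule cplx_carried[OF cL b(1)])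
  have "linkpart v c = 0"
    by (rule linkpart_eq_0) (use chains_nonzeroD[OF c(1)] vG in \<open>auto simp: cap_off_def\<close>)
  hence cyc: "bdry (linkpart v b) = 0" using b(2) by (intro bdry_linkpart_cycle[OF car]) simp
  then obtain h where h: "h \<in> chains F (Pow G) (Suc k)" "bdry h = linkpart v b"
    using exact_atD[OF exact_at_Pow[OF G0 GU] link_chain_Pow[OF b(1)]] by blast
  have "bdry (avoidpart v b + h) = c"
    using bdry_avoidpart[OF car vU] cyc h b by (simp add: bdry_add)
  moreover have "avoidpart v b + h \<in> chains F (cap_off v G L) (Suc k)"
    by (intro chains_add chains_mono[OF avoidpart_chains[OF b(1)]] chains_mono[OF h(1) cap_off_Pow])
      (auto simp: cap_off_def)
  ultimately show "\<exists>b\<in>chains F (cap_off v G L) (Suc k). bdry b = c" by blast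
qed

text \<open>Top cycles correspond under exchanging the star of \<open>v\<close> with a multiple of
  \<open>G\<close> having the same boundary. One direction carries the generator of \<open>L\<close>
  over, the other shows that the result still generates.\<close>

lemma cap_off_top_line:
  assumes "top_line L (card G)"
  shows "top_line (cap_off v G L) (card G)"
proof -
  let ?L = "cap_off v G L"
  have finG: "finite G" using GU finite_ground finite_subset by blast
  obtain m where m: "card G = Suc m" using G0 finG by (cases "card G") auto
  obtain z where z: "z \<in> chains F L (Suc m)" "z \<noteq> 0" "bdry z = 0"
    and top: "\<And>c. c \<in> chains F L (Suc m) \<Longrightarrow> bdry c = 0 \<Longrightarrow> \<exists>a. c = scal a z"
    using assms m by (auto simp: top_line_def)
  have car: "carried z" by (rule cplx_carried[OF cL z(1)])
  have "linkpart v (bdry z) = 0" by (simp only: z linkpart_0)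
  hence cyc: "bdry (linkpart v z) = 0" by (rule bdry_linkpart_cycle[OF car])
  then obtain h where h: "h \<in> chains F (Pow G) (Suc m)" "bdry h = linkpart v z"
    using exact_atD[OF exact_at_Pow[OF G0 GU] link_chain_Pow[OF z(1)]] by blast
  have onlyG: "\<sigma> = G" if "x \<in> chains F (Pow G) (Suc m)" "x \<sigma> \<noteq> 0" for x \<sigma>
    using chains_nonzeroD[OF that] finG m card_subset_eq[of G \<sigma>] by auto
  have inj: "x = y" if "x \<in> chains F (Pow G) (Suc m)" "y \<in> chains F (Pow G) (Suc m)" "bdry x = bdry y" for x y
  proof -
    have "x - y \<in> chains F (Pow G) (Suc m)" "bdry (x - y) = 0"
      using that by (auto intro: chains_diff simp: bdry_diff)
    then obtain w where w: "w \<in> chains F (Pow G) (Suc (Suc m))" "bdry w = x - y"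
      using exact_atD[OF exact_at_Pow[OF G0 GU]] by blast
    have "w = 0"
    proof (rule chains_eq_0[OF w(1)])
      fix \<sigma> assume "\<sigma> \<in> Pow G"
      hence "card \<sigma> \<le> Suc m" using card_mono[OF finG, of \<sigma>] m by simp
      thus "card \<sigma> \<noteq> Suc (Suc m)" by simp
    qed
    hence "x - y = 0" using w by simp
    thus ?thesis by simp
  qed
  let ?z = "avoidpart v z + h"
  have z1: "?z \<in> chains F ?L (Suc m)"
    by (intro chains_add chains_mono[OF avoidpart_chains[OF z(1)]] chains_mono[OF h(1) cap_off_Pow])
      (auto simp: cap_off_def)
  have z2: "bdry ?z = 0"
    using bdry_avoidpart[OF car vU] cyc h z by (simp add: bdry_add)
  \<comment> \<open>The chain \<open>h\<close> lives on \<open>G\<close> only, which is not in the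
    support of \<open>z\<close>. So nothing can cancel: \<open>h\<close> is zero, and then both
    parts of \<open>z\<close> are.\<close>
  have z3: "?z \<noteq> 0"
  proof
    assume 0: "?z = 0"
    have eq: "avoidpart v z \<sigma> = - h \<sigma>" for \<sigma>
      using fun_cong[OF 0, of \<sigma>] by (simp add: eq_neg_iff_add_eq_0)
    have "h \<sigma> = 0" for \<sigma>
    proof (rule ccontr)
      assume nz: "h \<sigma> \<noteq> 0"
      hence "\<sigma> = G" by (rule onlyG[OF h(1)])
      moreover have "z G = 0" using chains_nonzeroD[OF z(1)] GL by auto
      ultimately show False using eq[of \<sigma>] nz by (auto simp: avoidpart_def split: if_splits)
    qed
    hence h0: "h = 0" by auto
    hence "avoidpart v z = 0" using eq by auto
    moreover have "linkpart v z = 0" using h h0 by simp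
    ultimately have "z = 0" using avoidpart_plus_cone_linkpart[of v z] by simp
    thus False using z by simp
  qed
  have "\<exists>a. c = scal a ?z" if c: "c \<in> chains F ?L (Suc m)" "bdry c = 0" for c
  proof -
    \<comment> \<open>The reverse exchange: the multiple \<open>c1\<close> of \<open>G\<close> is
      replaced by the cone with apex \<open>v\<close> over its boundary.\<close>
    define c0 where "c0 \<sigma> = (if \<sigma> = G then 0 else c \<sigma>)" for \<sigma>
    define c1 where "c1 \<sigma> = (if \<sigma> = G then c \<sigma> else 0)" for \<sigma>
    have c01: "c = c0 + c1" by (auto simp: c0_def c1_def)
    have c1: "c1 \<in> chains F (Pow G) (Suc m)"
      using chains_nonzeroD[OF c(1), of G] by (auto simp: chains_def faces_card_def c1_def)
    have c0: "c0 \<in> chains F {\<tau> \<in> L. v \<notin> \<tau>} (Suc m)"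
      using c(1) by (auto simp: chains_def faces_card_def c0_def cap_off_def)
    have bc1: "bdry c1 \<in> chains F (Pow G) m" by (rule bdry_chains[OF cplx_Pow[OF GU] c1])
    have "bdry c1 \<in> chains F (Pow G - {G}) m" by (rule chains_restrict[OF bc1]) (use m in auto)
    hence "cone v (bdry c1) \<in> chains F L (Suc m)"
    proof (rule cone_chains)
      fix \<sigma> assume "\<sigma> \<in> Pow G - {G}"
      hence "\<sigma> \<subset> G" by auto
      thus "v \<notin> \<sigma> \<and> insert v \<sigma> \<in> L" using star[of \<sigma>] vG by auto
    qed
    moreover have "c0 \<in> chains F L (Suc m)" by (rule chains_mono[OF c0]) auto
    ultimately have b: "c0 + cone v (bdry c1) \<in> chains F L (Suc m)" by (rule chains_add[rotated])
    have nv: "bdry c1 \<sigma> = 0" if "v \<in> \<sigma>" for \<sigma> using chains_nonzeroD[OF bc1, of \<sigma>] that vG by auto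
    have nv0: "c0 \<sigma> = 0" if "v \<in> \<sigma>" for \<sigma> using chains_nonzeroD[OF c0, of \<sigma>] that by auto
    have "bdry (cone v (bdry c1)) = bdry c1 - cone v (bdry (bdry c1))"
      by (rule bdry_cone[OF cplx_carried[OF cplx_Pow[OF GU] bc1] vU nv])
    hence "bdry (cone v (bdry c1)) = bdry c1" using bdry_bdry_chains[OF cplx_Pow[OF GU] c1] by simp
    hence "bdry (c0 + cone v (bdry c1)) = 0" using c(2) c01 by (simp add: bdry_add)
    from top[OF b this] obtain a where a: "c0 + cone v (bdry c1) = scal a z" by blast
    have "avoidpart v (c0 + cone v (bdry c1)) = c0"
      by (rule ext) (simp add: avoidpart_def cone_def nv0)
    hence e0: "c0 = scal a (avoidpart v z)" using a by (simp add: avoidpart_scal)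
    have "linkpart v (c0 + cone v (bdry c1)) = bdry c1"
      by (rule ext) (simp add: linkpart_def cone_def nv0 nv)
    hence "bdry c1 = scal a (linkpart v z)" using a by (simp add: linkpart_scal)
    hence "bdry c1 = bdry (scal a h)" by (simp add: bdry_scal h)
    hence "c1 = scal a h" by (rule inj[OF c1 chains_scal[OF h(1)]])
    thus ?thesis using c01 e0 by (intro exI[of _ a]) (simp add: scal_add_right)
  qed
  thus ?thesis using z1 z2 z3 unfolding m top_line_def by blast
qed

end

text \<open>The link of \<open>G\<close> becomes \<open>{{}}\<close>, the sphere of dimension -1.
  The link of a proper face of \<open>G\<close> is its old link, capped off. Every other face keeps
  its link, since it forms no face together with \<open>v\<close>.\<close>

lemma cap_off_sph:
  assumes S: "sph n S" and v: "{v} \<in> S" and G: "card G = n" "link S {v} = Pow G - {G}" "v \<notin> G" "G \<subseteq> U"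
    and GS: "G \<notin> S" and n: "0 < n"
  shows "sph n (cap_off v G S)"
proof -
  note cS = sph_cplx[OF S]
  have vU: "v \<in> U" using cplx_face[OF cS v] by auto
  have finG: "finite G" using G finite_ground finite_subset by blast
  have star: "insert v \<tau> \<in> S \<longleftrightarrow> \<tau> \<subset> G" if "v \<notin> \<tau>" for \<tau>
  proof -
    have "insert v \<tau> \<in> S \<longleftrightarrow> \<tau> \<in> link S {v}" using that by (auto simp: mem_link)
    thus ?thesis by (auto simp: G(2))
  qed
  have G0: "G \<noteq> {}" using G n by auto
  have c: "cplx (cap_off v G S)" by (rule cap_off_cplx[OF cS vU G(4,3) GS star G0])
  have "card \<sigma> \<le> n \<and> (\<forall>k < n - card \<sigma>. exact_at (link (cap_off v G S) \<sigma>) k) \<and>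
      top_line (link (cap_off v G S) \<sigma>) (n - card \<sigma>)" if \<sigma>: "\<sigma> \<in> cap_off v G S" for \<sigma>
  proof -
    have fs: "finite \<sigma>" using cplx_face[OF c \<sigma>] by simp
    consider "\<sigma> = G" | "\<sigma> \<subset> G" | "\<not> \<sigma> \<subseteq> G" by auto
    thus ?thesis
    proof cases
      case 1
      have "link (cap_off v G S) G = {{}}"
      proof -
        have "\<rho> = {}" if "\<rho> \<in> link (cap_off v G S) G" for \<rho>
        proof -
          have "\<rho> \<union> G \<notin> S" using cplx_downward[OF cS, of "\<rho> \<union> G" G] GS by auto
          hence "\<rho> \<inter> G = {}" "\<rho> \<union> G = G" using that by (auto simp: mem_link cap_off_def)
          thus ?thesis by auto
        qed
        moreover have "{} \<in> link (cap_off v G S) G" by (simp add: mem_link cap_off_def)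
        ultimately show ?thesis by blast
      qed
      moreover have "top_line {{}} 0" unfolding top_line_def
      proof (intro bexI conjI ballI impI)
        show u: "unit_chain {} \<in> chains F {{}} 0" using unit_chain_chains[of "{}" "{{}}" F] by simp
        show "(unit_chain {} :: 'a set \<Rightarrow> 'k) \<noteq> 0" by (auto simp: unit_chain_def fun_eq_iff)
        show "bdry (unit_chain {}) = 0" by (rule bdry_chains_0[OF u])
        fix c :: "'a set \<Rightarrow> 'k" assume "c \<in> chains F {{}} 0"
        hence "c \<tau> = 0" if "\<tau> \<noteq> {}" for \<tau> using that chains_nonzeroD[of c F "{{}}" 0 \<tau>] by auto
        thus "\<exists>a. c = scal a (unit_chain {})"
          by (intro exI[of _ "c {}"] ext) (auto simp: scal_def unit_chain_def)
      qed
      ultimately show ?thesis using 1 G(1) by simp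
    next
      case 2
      have vs: "v \<notin> \<sigma>" using 2 G by auto
      have \<sigma>S: "\<sigma> \<in> S" using 2 \<sigma> by (auto simp: cap_off_def)
      have eq: "link (cap_off v G S) \<sigma> = cap_off v (G - \<sigma>) (link S \<sigma>)"
        using 2 vs by (auto simp: mem_link cap_off_def)
      have cd: "card (G - \<sigma>) = n - card \<sigma>" using 2 fs G(1) by (subst card_Diff_subset) auto
      have star': "insert v \<tau> \<in> link S \<sigma> \<longleftrightarrow> \<tau> \<subset> G - \<sigma>" if "v \<notin> \<tau>" for \<tau>
        using star[of "\<tau> \<union> \<sigma>"] that vs 2 by (auto simp: mem_link)
      have GL: "G - \<sigma> \<notin> link S \<sigma>" using GS 2 by (auto simp: mem_link Un_absorb2)
      have a: "v \<notin> G - \<sigma>" "G - \<sigma> \<subseteq> U" "G - \<sigma> \<noteq> {}" using G 2 by auto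
      note x = cplx_link[OF cS] vU a(2,1) GL star' a(3)
      have "exact_at (link (cap_off v G S) \<sigma>) k" if "k < n - card \<sigma>" for k
        unfolding eq by (rule cap_off_exact[OF x]) (use S \<sigma>S that cd in \<open>auto simp: sph_def\<close>)
      moreover have "top_line (link (cap_off v G S) \<sigma>) (n - card \<sigma>)"
        unfolding eq cd[symmetric] by (rule cap_off_top_line[OF x]) (use S \<sigma>S cd in \<open>auto simp: sph_def\<close>)
      ultimately show ?thesis using sph_card[OF S \<sigma>S] by auto
    next
      case 3
      have \<sigma>S: "\<sigma> \<in> S" "v \<notin> \<sigma>" using 3 \<sigma> by (auto simp: cap_off_def)
      have "v \<notin> \<rho>" if "\<rho> \<union> \<sigma> \<in> S" for \<rho>
      proof
        assume "v \<in> \<rho>"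
        hence "insert v \<sigma> \<in> S" by (intro cplx_downward[OF cS that]) auto
        thus False using star[OF \<sigma>S(2)] 3 by auto
      qed
      hence "link (cap_off v G S) \<sigma> = link S \<sigma>"
        using 3 \<sigma>S by (auto simp: mem_link cap_off_def)
      thus ?thesis using S \<sigma>S by (auto simp: sph_def)
    qed
  qed
  moreover have "{} \<in> cap_off v G S" using S by (auto simp: sph_def cap_off_def)
  ultimately show ?thesis using c by (simp add: sph_def)
qed

text \<open>If \<open>W\<close> does not contain \<open>G\<close>, the induced subcomplex is one of
  \<open>S\<close> avoiding \<open>v\<close>. Otherwise it is obtained by capping off the subcomplex
  of \<open>S\<close> induced on \<open>insert v W\<close>, which contains the whole star of
  \<open>v\<close> whether or not \<open>v\<close> belongs to \<open>W\<close>.\<close>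

lemma cap_off_hollow:
  assumes H: "hollow n S" and cS: "cplx S" and v: "{v} \<in> S"
    and G: "card G = n" "link S {v} = Pow G - {G}" "v \<notin> G" "G \<subseteq> U" and GS: "G \<notin> S" and n: "0 < n"
  shows "hollow n (cap_off v G S)"
  unfolding hollow_def
proof (intro allI impI)
  fix W k assume k: "2 \<le> k \<and> k + 2 \<le> n"
  have vU: "v \<in> U" using cplx_face[OF cS v] by auto
  have G0: "G \<noteq> {}" using G n by auto
  show "exact_at (induced (cap_off v G S) W) k"
  proof (cases "G \<subseteq> W")
    case False
    hence "induced (cap_off v G S) W = induced S (W - {v})"
      by (auto simp: mem_induced cap_off_def)
    thus ?thesis using H k by (simp add: hollow_def)
  next
    case True
    have eq: "induced (cap_off v G S) W = cap_off v G (induced S (insert v W))"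
      using True by (auto simp: mem_induced cap_off_def)
    have "insert v \<tau> \<in> induced S (insert v W) \<longleftrightarrow> \<tau> \<subset> G" if "v \<notin> \<tau>" for \<tau>
    proof -
      have "insert v \<tau> \<in> S \<longleftrightarrow> \<tau> \<in> link S {v}" using that by (auto simp: mem_link)
      thus ?thesis using True by (auto simp: G(2) mem_induced)
    qed
    moreover have "G \<notin> induced S (insert v W)" using GS by (auto simp: mem_induced)
    moreover have "exact_at (induced S (insert v W)) k" using H k by (simp add: hollow_def)
    ultimately show ?thesis unfolding eq
      using k G by (intro cap_off_exact[OF cplx_induced[OF cS] vU G(4,3) _ _ G0]) auto
  qed
qed

subsection \<open>Stacked fillings\<close>

text \<open>The filling is a tree of \<open>n\<close>-simplices with boundary \<open>S\<close>. The links of faces with at least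
  \<open>n\<close> vertices are recorded explicitly, so that no Betti number has to be computed when a
  simplex is attached.\<close>

definition stacked_filling :: "nat \<Rightarrow> 'a set set \<Rightarrow> 'a set set \<Rightarrow> bool" where
  "stacked_filling n S B \<longleftrightarrow> cplx B \<and> S \<subseteq> B \<and> \<Union>B \<subseteq> \<Union>S \<and> (\<exists>\<sigma>\<in>B. card \<sigma> = Suc n) \<and>
     (\<forall>\<sigma>\<in>B. card \<sigma> \<le> Suc n) \<and>
     (\<forall>\<sigma>\<in>S. card \<sigma> \<le> n \<and> (\<forall>k. exact_at (link B \<sigma>) k)) \<and>
     (\<forall>\<sigma>\<in>S. card \<sigma> = n \<longrightarrow> (\<exists>x. link B \<sigma> = {{}, {x}})) \<and>
     (\<forall>\<sigma>\<in>B. \<sigma> \<notin> S \<longrightarrow> card \<sigma> = Suc n \<or> card \<sigma> = n \<and> (\<exists>x y. x \<noteq> y \<and> link B \<sigma> = {{}, {x}, {y}}))"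

lemma link_Pow: "\<sigma> \<subseteq> G \<Longrightarrow> link (Pow G) \<sigma> = Pow (G - \<sigma>)"
  by (auto simp: mem_link)

lemma stacked_filling_simplex:
  assumes "card G = Suc n" "G \<subseteq> U" "0 < n"
  shows "stacked_filling n (Pow G - {G}) (Pow G)"
proof -
  have fin: "finite G" using assms finite_ground finite_subset by blast
  have lt: "card \<sigma> \<le> n" if "\<sigma> \<subset> G" for \<sigma> using psubset_card_mono[OF fin that] assms by simp
  have "exact_at (link (Pow G) \<sigma>) k" if "\<sigma> \<subset> G" for \<sigma> k
    using that assms by (subst link_Pow) (auto intro!: exact_at_Pow)
  moreover have "\<exists>x. link (Pow G) \<sigma> = {{}, {x}}" if "\<sigma> \<subset> G" "card \<sigma> = n" for \<sigma>
  proof -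
    have "card (G - \<sigma>) = 1" using that assms fin finite_subset[of \<sigma> G] by (subst card_Diff_subset) auto
    then obtain x where "G - \<sigma> = {x}" by (auto simp: card_1_singleton_iff)
    thus ?thesis using that by (subst link_Pow) auto
  qed
  moreover have "card \<sigma> \<le> Suc n" if "\<sigma> \<subseteq> G" for \<sigma> using card_mono[OF fin that] assms by simp
  moreover have "\<Union>(Pow G) \<subseteq> \<Union>(Pow G - {G})"
  proof
    fix x assume "x \<in> \<Union>(Pow G)"
    moreover have "G \<noteq> {x}" using assms by auto
    ultimately have "{x} \<in> Pow G - {G}" by auto
    thus "x \<in> \<Union>(Pow G - {G})" by blast
  qed
  ultimately show ?thesis using assms cplx_Pow lt unfolding stacked_filling_def by (auto simp: psubset_eq)
qed

text \<open>The simplex on \<open>v\<close> and \<open>G\<close> is collapsed onto \<open>G\<close>: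
  the star of \<open>v\<close> in a cycle \<open>c\<close> is replaced by a chain \<open>h\<close>
  of \<open>G\<close> with the same boundary, the result is filled in \<open>L\<close>, and
  \<open>cone v h\<close> accounts for the difference.\<close>

lemma exact_at_attach_simplex:
  assumes cL: "cplx L" and G: "G \<in> L" "G \<noteq> {}" and v: "v \<in> U" "v \<notin> \<Union>L" and ex: "\<And>k. exact_at L k"
  shows "exact_at (L \<union> Pow (insert v G)) k"
  unfolding exact_at_def
proof (intro ballI impI)
  let ?M = "L \<union> Pow (insert v G)"
  fix c assume c: "c \<in> chains F ?M k" "bdry c = 0"
  have GU: "G \<subseteq> U" using cplx_face[OF cL G(1)] by auto
  have vG: "v \<notin> G" using v G by auto
  have sub: "Pow G \<subseteq> L" using cplx_downward[OF cL G(1)] by auto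
  have cM: "cplx ?M" by (rule cplxI) (use cplx_face[OF cL] GU v cplx_downward[OF cL] in auto)
  have car: "carried c" by (rule cplx_carried[OF cM c(1)])
  have "linkpart v (bdry c) = 0" by (simp only: c linkpart_0)
  hence cyc: "bdry (linkpart v c) = 0" by (rule bdry_linkpart_cycle[OF car])
  obtain h where h: "h \<in> chains F (Pow G) k" "bdry h = linkpart v c"
  proof (cases k)
    case 0
    hence "linkpart v c = 0" using linkpart_chains_0[of c F ?M] c by simp
    thus ?thesis by (intro that[of 0]) auto
  next
    case (Suc j)
    have "linkpart v c \<in> chains F (Pow G) j"
      by (rule chains_mono[OF linkpart_chains[of c F ?M]]) (use c Suc v in \<open>auto simp: mem_link\<close>)
    from exact_atD[OF exact_at_Pow[OF G(2) GU] this cyc] that Suc show ?thesis by blast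
  qed
  have nv: "h \<sigma> = 0" if "v \<in> \<sigma>" for \<sigma> using chains_nonzeroD[OF h(1), of \<sigma>] that vG by auto
  have "avoidpart v c \<in> chains F L k"
    by (rule chains_mono[OF avoidpart_chains[OF c(1)]]) (use sub in auto)
  hence a: "avoidpart v c + h \<in> chains F L k" by (rule chains_add) (rule chains_mono[OF h(1) sub])
  moreover have "bdry (avoidpart v c + h) = 0"
    using bdry_avoidpart[OF car v(1)] cyc h c by (simp add: bdry_add)
  ultimately obtain b where b: "b \<in> chains F L (Suc k)" "bdry b = avoidpart v c + h"
    using exact_atD[OF ex] by blast
  have "bdry (cone v h) = h - cone v (linkpart v c)"
    using bdry_cone[OF cplx_carried[OF cplx_Pow[OF GU] h(1)] v(1) nv] h by simp
  hence "bdry (b - cone v h) = avoidpart v c + cone v (linkpart v c)" using b by (simp add: bdry_diff)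
  also have "\<dots> = c" by (rule avoidpart_plus_cone_linkpart)
  finally have "bdry (b - cone v h) = c" .
  moreover have "cone v h \<in> chains F ?M (Suc k)" by (rule cone_chains[OF h(1)]) (use vG in auto)
  moreover have "b \<in> chains F ?M (Suc k)" by (rule chains_mono[OF b(1)]) auto
  ultimately show "\<exists>b\<in>chains F ?M (Suc k). bdry b = c" using chains_diff by blast
qed

text \<open>The new simplex meets \<open>B\<close> exactly in the faces of \<open>G\<close>. So
  \<open>G\<close> becomes interior, with \<open>v\<close> as its second neighbour; the links of
  proper faces of \<open>G\<close> get a simplex attached; proper faces of the new simplex
  containing \<open>v\<close> have a simplex as link; faces outside it keep their links.\<close>

lemma stacked_filling_attach:
  assumes B: "stacked_filling n (cap_off v G S) B" and cS: "cplx S" and v: "{v} \<in> S"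
    and G: "card G = n" "link S {v} = Pow G - {G}" "v \<notin> G" "G \<subseteq> U" and GS: "G \<notin> S" and n: "2 \<le> n"
  shows "stacked_filling n S (B \<union> Pow (insert v G))"
proof -
  let ?S = "cap_off v G S" and ?B = "B \<union> Pow (insert v G)"
  have vU: "v \<in> U" using cplx_face[OF cS v] by auto
  have finG: "finite G" using G finite_ground finite_subset by blast
  have star: "insert v \<tau> \<in> S \<longleftrightarrow> \<tau> \<subset> G" if "v \<notin> \<tau>" for \<tau>
  proof -
    have "insert v \<tau> \<in> S \<longleftrightarrow> \<tau> \<in> link S {v}" using that by (auto simp: mem_link)
    thus ?thesis by (auto simp: G(2))
  qed
  have cB: "cplx B" and SB: "?S \<subseteq> B" and UB: "\<Union>B \<subseteq> \<Union>?S" and cardB: "\<And>\<sigma>. \<sigma> \<in> B \<Longrightarrow> card \<sigma> \<le> Suc n"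
    and S1: "\<And>\<sigma> k. \<sigma> \<in> ?S \<Longrightarrow> exact_at (link B \<sigma>) k" and Sn: "\<And>\<sigma>. \<sigma> \<in> ?S \<Longrightarrow> card \<sigma> \<le> n"
    and S2: "\<And>\<sigma>. \<sigma> \<in> ?S \<Longrightarrow> card \<sigma> = n \<Longrightarrow> \<exists>x. link B \<sigma> = {{}, {x}}"
    and B1: "\<And>\<sigma>. \<sigma> \<in> B \<Longrightarrow> \<sigma> \<notin> ?S \<Longrightarrow> card \<sigma> = Suc n \<or> card \<sigma> = n \<and> (\<exists>x y. x \<noteq> y \<and> link B \<sigma> = {{}, {x}, {y}})"
    using B unfolding stacked_filling_def by auto
  \<comment> \<open>Here the clause on \<open>\<Union>B\<close> in \<open>stacked_filling\<close>
    enters: the filling has only the vertices of its boundary, and \<open>v\<close> is not one of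
    them.\<close>
  have vB: "v \<notin> \<sigma>" if "\<sigma> \<in> B" for \<sigma>
  proof -
    have "v \<notin> \<Union>?S" using G by (auto simp: cap_off_def)
    thus ?thesis using UB that by auto
  qed
  have GB: "G \<in> B" using SB by (auto simp: cap_off_def)
  have cvG: "card (insert v G) = Suc n" using G finG by simp
  have PG: "\<tau> \<in> S" if "\<tau> \<subset> G" for \<tau>
    using star[of \<tau>] that G(3) cplx_downward[OF cS, of "insert v \<tau>" \<tau>] by auto
  have Snv: "\<sigma> \<in> S \<longleftrightarrow> \<sigma> \<in> ?S \<and> \<sigma> \<noteq> G" if "v \<notin> \<sigma>" for \<sigma> using that GS by (auto simp: cap_off_def)
  have Sv: "\<sigma> \<in> S \<longleftrightarrow> \<sigma> \<subset> insert v G \<and> \<sigma> \<noteq> G" if vs: "v \<in> \<sigma>" for \<sigma>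
  proof -
    have "\<sigma> \<in> S \<longleftrightarrow> \<sigma> - {v} \<subset> G" using star[of "\<sigma> - {v}"] vs by (simp add: insert_absorb)
    also have "\<dots> \<longleftrightarrow> \<sigma> \<subset> insert v G \<and> \<sigma> \<noteq> G" using vs G(3) by auto
    finally show ?thesis .
  qed
  have cM: "cplx ?B"
  proof (rule cplxI)
    show "\<sigma> \<subseteq> U" if "\<sigma> \<in> ?B" for \<sigma> using that cplx_face[OF cB, of \<sigma>] G(4) vU by auto
    show "\<tau> \<in> ?B" if "\<sigma> \<in> ?B" "\<tau> \<subseteq> \<sigma>" for \<sigma> \<tau>
      using that cplx_downward[OF cB, of \<sigma> \<tau>] by auto
  qed
  have link_v: "link ?B \<sigma> = Pow (insert v G - \<sigma>)" if "v \<in> \<sigma>" "\<sigma> \<subseteq> insert v G" for \<sigma>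
  proof (rule set_eqI)
    fix \<rho>
    have "\<rho> \<union> \<sigma> \<notin> B" using vB[of "\<rho> \<union> \<sigma>"] that by auto
    hence "\<rho> \<in> link ?B \<sigma> \<longleftrightarrow> \<rho> \<inter> \<sigma> = {} \<and> \<rho> \<subseteq> insert v G" using that by (simp add: mem_link)
    also have "\<dots> \<longleftrightarrow> \<rho> \<in> Pow (insert v G - \<sigma>)" using that by blast
    finally show "\<rho> \<in> link ?B \<sigma> \<longleftrightarrow> \<rho> \<in> Pow (insert v G - \<sigma>)" .
  qed
  have link_out: "link ?B \<sigma> = link B \<sigma>" if "\<not> \<sigma> \<subseteq> insert v G" for \<sigma>
    by (rule set_eqI) (use that in \<open>simp add: mem_link\<close>)
  have link_in: "link ?B \<sigma> = link B \<sigma> \<union> Pow (insert v (G - \<sigma>))" if "v \<notin> \<sigma>" "\<sigma> \<subseteq> G" for \<sigma>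
  proof (rule set_eqI)
    fix \<rho>
    have "\<rho> \<inter> \<sigma> = {} \<and> \<rho> \<union> \<sigma> \<subseteq> insert v G \<longleftrightarrow> \<rho> \<subseteq> insert v (G - \<sigma>)" using that by blast
    thus "\<rho> \<in> link ?B \<sigma> \<longleftrightarrow> \<rho> \<in> link B \<sigma> \<union> Pow (insert v (G - \<sigma>))"
      by (auto simp only: mem_link Un_iff Pow_iff)
  qed
  have S_sub: "S \<subseteq> ?B"
  proof
    fix \<sigma> assume \<sigma>: "\<sigma> \<in> S"
    show "\<sigma> \<in> ?B"
    proof (cases "v \<in> \<sigma>")
      case True
      hence "\<sigma> \<subset> insert v G" using Sv \<sigma> by simp
      thus ?thesis by blast
    next
      case False
      hence "\<sigma> \<in> ?S" using Snv \<sigma> by simp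
      thus ?thesis using SB by blast
    qed
  qed
  have U_sub: "\<Union>?B \<subseteq> \<Union>S"
  proof -
    have "x \<in> \<Union>S" if x: "x \<in> G" for x
    proof -
      have "G \<noteq> {x}" using G(1) n by auto
      hence "{x} \<in> S" using x by (intro PG psubsetI) auto
      thus ?thesis by blast
    qed
    moreover have "v \<in> \<Union>S" using v by blast
    moreover have "\<Union>?S \<subseteq> \<Union>S \<union> G" by (auto simp: cap_off_def)
    ultimately show ?thesis using UB by blast
  qed
  have S_link: "card \<sigma> \<le> n \<and> (\<forall>k. exact_at (link ?B \<sigma>) k) \<and> (card \<sigma> = n \<longrightarrow> (\<exists>x. link ?B \<sigma> = {{}, {x}}))"
    if \<sigma>: "\<sigma> \<in> S" for \<sigma>
  proof (cases "v \<in> \<sigma>")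
    case True
    hence sub: "\<sigma> \<subset> insert v G" using Sv \<sigma> by simp
    have "card \<sigma> < Suc n" using psubset_card_mono[OF _ sub] cvG finG by simp
    moreover have "exact_at (link ?B \<sigma>) k" for k
      unfolding link_v[OF True psubset_imp_subset[OF sub]] using sub G(4) vU by (intro exact_at_Pow) auto
    moreover have "\<exists>x. link ?B \<sigma> = {{}, {x}}" if "card \<sigma> = n"
    proof -
      have "card (insert v G - \<sigma>) = 1"
        using sub that cvG finG finite_subset[of \<sigma> "insert v G"] by (subst card_Diff_subset) auto
      then obtain x where "insert v G - \<sigma> = {x}" by (auto simp: card_1_singleton_iff)
      thus ?thesis using link_v[OF True psubset_imp_subset[OF sub]] by auto
    qed
    ultimately show ?thesis by auto
  next
    case False
    hence \<sigma>': "\<sigma> \<in> ?S" "\<sigma> \<noteq> G" using Snv \<sigma> by auto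
    show ?thesis
    proof (cases "\<sigma> \<subseteq> G")
      case True
      hence sub: "\<sigma> \<subset> G" using \<sigma>' by auto
      have "card \<sigma> < n" using psubset_card_mono[OF finG sub] G by simp
      moreover have "exact_at (link ?B \<sigma>) k" for k
        unfolding link_in[OF False True]
      proof (rule exact_at_attach_simplex[OF cplx_link[OF cB]])
        show "G - \<sigma> \<in> link B \<sigma>" using GB True by (auto simp: mem_link Un_absorb2)
        show "v \<notin> \<Union>(link B \<sigma>)" using vB link_subset[OF cB] by blast
      qed (use sub vU S1[OF \<sigma>'(1)] in auto)
      ultimately show ?thesis by auto
    next
      case out: False
      hence "\<not> \<sigma> \<subseteq> insert v G" using False by auto
      thus ?thesis using link_out S1[OF \<sigma>'(1)] S2[OF \<sigma>'(1)] Sn[OF \<sigma>'(1)] by auto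
    qed
  qed
  have B_link: "card \<sigma> = Suc n \<or> card \<sigma> = n \<and> (\<exists>x y. x \<noteq> y \<and> link ?B \<sigma> = {{}, {x}, {y}})"
    if \<sigma>: "\<sigma> \<in> ?B" "\<sigma> \<notin> S" for \<sigma>
  proof (cases "v \<in> \<sigma>")
    case True
    hence "\<sigma> \<subseteq> insert v G" using \<sigma>(1) vB[of \<sigma>] by blast
    moreover have "\<not> \<sigma> \<subset> insert v G" using Sv[OF True] \<sigma>(2) True G(3) by blast
    ultimately have "\<sigma> = insert v G" by blast
    thus ?thesis by (simp only: cvG simp_thms)
  next
    case False
    hence \<sigma>B: "\<sigma> \<in> B" using \<sigma>(1) cplx_downward[OF cB GB, of \<sigma>] by auto
    show ?thesis
    proof (cases "\<sigma> = G")
      case True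
      obtain x where x: "link B G = {{}, {x}}" using S2[of G] G(1) by (auto simp: cap_off_def)
      hence "{x} \<in> link B G" by simp
      hence "x \<noteq> v" using vB link_subset[OF cB] by blast
      moreover have "link ?B G = {{}, {x}, {v}}" using link_in[OF G(3) subset_refl] x by auto
      ultimately have "card \<sigma> = n \<and> (\<exists>x y. x \<noteq> y \<and> link ?B \<sigma> = {{}, {x}, {y}})"
        using True G(1) by blast
      thus ?thesis ..
    next
      case False': False
      hence "\<sigma> \<notin> ?S" using Snv[OF False] \<sigma> by auto
      moreover have "\<not> \<sigma> \<subseteq> G" using PG[of \<sigma>] False' \<sigma> by auto
      hence "\<not> \<sigma> \<subseteq> insert v G" using False by auto
      ultimately show ?thesis using B1[OF \<sigma>B] link_out by metis
    qed
  qed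
  show ?thesis
    unfolding stacked_filling_def
  proof (intro conjI ballI allI impI)
    show "cplx ?B" "S \<subseteq> ?B" "\<Union>?B \<subseteq> \<Union>S" by fact+
    show "\<exists>\<sigma>\<in>?B. card \<sigma> = Suc n" by (rule bexI[of _ "insert v G"]) (simp_all only: cvG, blast)
    show "card \<sigma> \<le> Suc n" if "\<sigma> \<in> ?B" for \<sigma>
    proof (cases "\<sigma> \<in> B")
      case True
      thus ?thesis by (rule cardB)
    next
      case False
      hence "card \<sigma> \<le> card (insert v G)" using that finG by (intro card_mono) auto
      thus ?thesis by (simp only: cvG)
    qed
    show "card \<sigma> \<le> n" "exact_at (link ?B \<sigma>) k" if "\<sigma> \<in> S" for \<sigma> k
      using S_link[OF that] by simp_all
    show "\<exists>x. link ?B \<sigma> = {{}, {x}}" if "\<sigma> \<in> S" "card \<sigma> = n" for \<sigma>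
      using S_link[OF that(1)] that(2) by simp
    show "card \<sigma> = Suc n \<or> card \<sigma> = n \<and> (\<exists>x y. x \<noteq> y \<and> link ?B \<sigma> = {{}, {x}, {y}})"
      if "\<sigma> \<in> ?B" "\<sigma> \<notin> S" for \<sigma>
      by (rule B_link[OF that])
  qed
qed

lemma stacked_filling_exists:
  assumes "sph n S" "4 \<le> n" "hollow n S"
  shows "\<exists>B. stacked_filling n S B"
  using assms
proof (induction "card {x. {x} \<in> S}" arbitrary: S rule: less_induct)
  case less
  note S = less.prems(1) and H = less.prems(3)
  note cS = sph_cplx[OF S]
  have facet: "\<exists>\<tau>\<in>S. \<sigma> \<subseteq> \<tau> \<and> card \<tau> = n" if "\<sigma> \<in> S" for \<sigma> using sph_facet[OF S that] by metis
  obtain \<tau> where \<tau>: "\<tau> \<in> S" "card \<tau> = n" using facet[of "{}"] S by (auto simp: sph_def)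
  have "\<tau> \<noteq> {}" using \<tau>(2) less.prems(2) by auto
  then obtain u where "u \<in> \<tau>" by blast
  hence u: "{u} \<in> S" by (intro cplx_downward[OF cS \<tau>(1)]) simp
  have ex: "exact_at (induced S W) 2" for W using H less.prems(2) by (simp add: hollow_def)
  obtain v where v: "{v} \<in> S"
    and simp: "\<And>x y. {v, x} \<in> S \<Longrightarrow> {v, y} \<in> S \<Longrightarrow> {x, y} \<in> S"
    using simplicial_vertex_exists[OF cS ex u] by metis
  obtain G where G: "card G = n" "link S {v} = Pow G - {G}" "v \<notin> G" "G \<subseteq> U"
    by (rule simplicial_vertex_link[OF S less.prems(2) H v simp])
  have vU: "v \<in> U" using cplx_face[OF cS v] by auto
  have finG: "finite G" using G finite_ground finite_subset by blast
  have n0: "0 < n" using less.prems by simp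
  have cvG: "card (insert v G) = Suc n" using G finG by simp
  have GU: "insert v G \<subseteq> U" using G vU by auto
  show ?case
  proof (cases "G \<in> S")
    case True
    have sub: "Pow (insert v G) - {insert v G} \<subseteq> S"
    proof
      fix \<sigma> assume \<sigma>: "\<sigma> \<in> Pow (insert v G) - {insert v G}"
      show "\<sigma> \<in> S"
      proof (cases "v \<in> \<sigma>")
        case False
        thus ?thesis using \<sigma> by (intro cplx_downward[OF cS True]) auto
      next
        case vs: True
        hence "\<sigma> - {v} \<in> link S {v}" using \<sigma> G by auto
        thus ?thesis using vs by (auto simp: mem_link insert_absorb)
      qed
    qed
    \<comment> \<open>The boundary of the simplex on \<open>v\<close> and \<open>G\<close> is a
      nonzero top cycle of \<open>S\<close>, so every facet of \<open>S\<close> lies in its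
      support.\<close>
    let ?c = "bdry (unit_chain (insert v G))"
    have c1: "?c \<in> chains F (Pow (insert v G) - {insert v G}) n"
      by (rule bdry_unit_chain_chains[OF GU cvG])
    have c2: "?c \<in> chains F S n" by (rule chains_mono[OF c1 sub])
    have "S \<subseteq> Pow (insert v G) - {insert v G}"
    proof
      fix \<sigma> assume \<sigma>: "\<sigma> \<in> S"
      then obtain \<tau> where \<tau>: "\<tau> \<in> S" "\<sigma> \<subseteq> \<tau>" "card \<tau> = n" using facet by blast
      have "?c \<tau> \<noteq> 0"
        by (rule top_cycle_nonzero[OF S c2 bdry_bdry_unit_chain[OF GU] _ \<tau>(1,3)])
          (rule bdry_unit_chain_nonzero[OF GU], simp)
      hence "\<tau> \<subseteq> insert v G" using chains_nonzeroD[OF c1] by auto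
      moreover have "\<sigma> \<noteq> insert v G" using sph_card[OF S \<sigma>] cvG by auto
      ultimately show "\<sigma> \<in> Pow (insert v G) - {insert v G}" using \<tau> by auto
    qed
    hence "S = Pow (insert v G) - {insert v G}" using sub by auto
    thus ?thesis using stacked_filling_simplex[OF cvG GU n0] by auto
  next
    case False
    let ?S = "cap_off v G S"
    have "{x. {x} \<in> ?S} \<subset> {x. {x} \<in> S}"
    proof -
      have "G \<noteq> {x}" for x using G(1) less.prems(2) by auto
      thus ?thesis using v by (auto simp: cap_off_def)
    qed
    moreover have "finite {x. {x} \<in> S}"
      by (rule finite_subset[OF _ finite_ground]) (auto dest: cplx_face[OF cS])
    ultimately have "card {x. {x} \<in> ?S} < card {x. {x} \<in> S}" by (intro psubset_card_mono)
    from less.hyps[OF this cap_off_sph[OF S v G False n0] less.prems(2) cap_off_hollow[OF H cS v G False n0]]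
    obtain B where "stacked_filling n ?S B" by blast
    from stacked_filling_attach[OF this cS v G False] less.prems(2) show ?thesis by auto
  qed
qed

end

subsection \<open>Betti numbers\<close>

interpretation chain_space: vector_space "scal :: 'k::field \<Rightarrow> ('a set \<Rightarrow> 'k) \<Rightarrow> 'a set \<Rightarrow> 'k"
  by unfold_locales (auto simp: scal_def algebra_simps)

lemma chain_dim_eq:
  fixes F :: "'k::field itself" and V :: "('a set \<Rightarrow> 'k) set"
  shows "chain_dim F V = chain_space.dim V"
proof -
  have "(\<lambda>a f x. a * f x) = (scal :: 'k \<Rightarrow> ('a set \<Rightarrow> 'k) \<Rightarrow> 'a set \<Rightarrow> 'k)"
    by (intro ext) (simp add: scal_def)
  thus ?thesis by (simp add: chain_dim_def)
qed

lemma mem_span_unit_chains: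
  fixes c :: "'a set \<Rightarrow> 'k::field"
  assumes "finite A" "\<And>\<sigma>. c \<sigma> \<noteq> 0 \<Longrightarrow> \<sigma> \<in> A"
  shows "c \<in> chain_space.span (unit_chain ` A)"
  using assms
proof (induction A arbitrary: c rule: finite_induct)
  case empty
  hence "c = 0" by (intro ext) auto
  thus ?case by (simp only: chain_space.span_zero)
next
  case (insert \<tau> A)
  let ?c = "\<lambda>\<sigma>. if \<sigma> = \<tau> then 0 else c \<sigma>"
  have "?c \<in> chain_space.span (unit_chain ` A)"
    by (rule insert.IH) (use insert.prems in \<open>auto split: if_splits\<close>)
  hence "?c \<in> chain_space.span (unit_chain ` insert \<tau> A)"
    using chain_space.span_mono[of "unit_chain ` A" "unit_chain ` insert \<tau> A"] by auto
  moreover have "scal (c \<tau>) (unit_chain \<tau>) \<in> chain_space.span (unit_chain ` insert \<tau> A)"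
    by (intro chain_space.span_scale chain_space.span_base) auto
  moreover have "c = ?c + scal (c \<tau>) (unit_chain \<tau>)"
    by (rule ext) (simp add: scal_def unit_chain_def)
  ultimately show ?case using chain_space.span_add by metis
qed

text \<open>A basis of \<open>A\<close> extends to a basis of \<open>B\<close>; the finite spanning
  set makes the latter finite, so the comparison of dimensions forces the two bases to
  coincide.\<close>

lemma (in vector_space) dim_le_imp_subset:
  assumes "subspace A" "A \<subseteq> B" "B \<subseteq> span C" "finite C" "dim B \<le> dim A"
  shows "B \<subseteq> A"
proof -
  obtain a where a: "a \<subseteq> A" "independent a" "A \<subseteq> span a" "card a = dim A" by (rule basis_exists)
  obtain b where b: "a \<subseteq> b" "b \<subseteq> B" "independent b" "B \<subseteq> span b"
    using maximal_independent_subset_extend[of a B] a assms(2) by (metis order_trans)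
  have "finite b" using independent_span_bound[OF assms(4) b(3)] b(2) assms(3) by auto
  moreover have "card b \<le> card a" using basis_card_eq_dim[OF b(2,4,3)] a(4) assms(5) by simp
  ultimately have "a = b" using b(1) card_seteq by blast
  thus ?thesis using b(4) span_minimal[OF a(1) assms(1)] by auto
qed

context ground
begin

text \<open>The faces with \<open>k\<close> vertices above \<open>\<tau>\<close> correspond to the
  vertices that can be added to \<open>\<tau>\<close>. Here \<open>incidence\<close> recovers the
  added vertex by \<open>the_elem\<close>, while \<open>ins_sign\<close> receives it as an
  argument.\<close>

lemma bd_eq_bdry:
  assumes K: "cplx K" and c: "c \<in> chains F K k"
  shows "bd K k c = bdry c"
proof (rule ext)
  fix \<tau>
  show "bd K k c \<tau> = bdry c \<tau>"
  proof (cases "1 \<le> k \<and> \<tau> \<in> faces_card K (k - 1)")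
    case True
    hence \<tau>: "\<tau> \<subseteq> U" "finite \<tau>" "card \<tau> = k - 1" "1 \<le> k" using cplx_face[OF K] by (auto simp: faces_card_def)
    let ?Y = "{y \<in> U - \<tau>. insert y \<tau> \<in> faces_card K k}"
    have "bij_betw (\<lambda>y. insert y \<tau>) ?Y {\<sigma> \<in> faces_card K k. \<tau> \<subset> \<sigma>}"
      unfolding bij_betw_def
    proof
      show "inj_on (\<lambda>y. insert y \<tau>) ?Y" by (auto simp: inj_on_def)
      show "(\<lambda>y. insert y \<tau>) ` ?Y = {\<sigma> \<in> faces_card K k. \<tau> \<subset> \<sigma>}"
      proof (intro equalityI subsetI)
        fix \<sigma> assume "\<sigma> \<in> {\<sigma> \<in> faces_card K k. \<tau> \<subset> \<sigma>}"
        hence \<sigma>: "\<sigma> \<in> faces_card K k" "\<tau> \<subset> \<sigma>" by auto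
        hence fs: "\<sigma> \<in> K" "finite \<sigma>" "card \<sigma> = k" by (auto simp: faces_card_def)
        have "card (\<sigma> - \<tau>) = 1" using \<sigma> fs \<tau> by (subst card_Diff_subset) auto
        then obtain y where "\<sigma> - \<tau> = {y}" by (auto simp: card_1_singleton_iff)
        hence "\<sigma> = insert y \<tau>" "y \<in> U - \<tau>" using \<sigma> cplx_face[OF K fs(1)] by auto
        thus "\<sigma> \<in> (\<lambda>y. insert y \<tau>) ` ?Y" using \<sigma> by auto
      qed auto
    qed
    hence "(\<Sum>\<sigma>\<in>{\<sigma> \<in> faces_card K k. \<tau> \<subset> \<sigma>}. incidence \<tau> \<sigma> * c \<sigma>)
         = (\<Sum>y\<in>?Y. incidence \<tau> (insert y \<tau>) * c (insert y \<tau>))"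
      by (rule sum.reindex_bij_betw[symmetric])
    also have "\<dots> = (\<Sum>y\<in>?Y. ins_sign y \<tau> * c (insert y \<tau>))"
      by (intro sum.cong refl) (auto simp: incidence_def ins_sign_def insert_Diff_if)
    also have "\<dots> = bdry c \<tau>"
      unfolding bdry_def
      by (rule sum.mono_neutral_left) (use finite_ground c in \<open>auto simp: chains_def\<close>)
    finally show ?thesis using True by (simp add: bd_def)
  next
    case False
    have "bdry c \<tau> = 0"
    proof (cases k)
      case 0
      thus ?thesis using bdry_chains_0 c by simp
    next
      case (Suc j)
      thus ?thesis using False chains_nonzeroD[OF bdry_chains[OF K, of c j], of \<tau>] c
        by (auto simp: faces_card_def)
    qed
    thus ?thesis unfolding bd_def by (simp only: if_not_P[OF False])
  qed
qed

lemma cycles_eq: "cplx K \<Longrightarrow> cycles F K k = {c \<in> chains F K k. bdry c = 0}"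
  by (auto simp: cycles_def bd_eq_bdry)

lemma boundaries_eq: "cplx K \<Longrightarrow> boundaries F K k = bdry ` chains F K (Suc k)"
  by (auto simp: boundaries_def bd_eq_bdry)

lemma boundaries_subset_cycles: "cplx K \<Longrightarrow> boundaries F K k \<subseteq> cycles F K k"
  by (auto simp: cycles_eq boundaries_eq bdry_chains bdry_bdry_chains)

lemma exact_at_iff: "cplx K \<Longrightarrow> exact_at K k \<longleftrightarrow> cycles F K k \<subseteq> boundaries F K k"
  by (auto simp: exact_at_def cycles_eq boundaries_eq)

lemma subspace_boundaries:
  assumes "cplx K"
  shows "chain_space.subspace (boundaries F K k)"
proof (rule chain_space.subspaceI)
  show "0 \<in> boundaries F K k" unfolding boundaries_eq[OF assms]
    by (rule image_eqI[of _ _ 0]) (simp only: bdry_0, rule chains_0)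
  show "x + y \<in> boundaries F K k" if "x \<in> boundaries F K k" "y \<in> boundaries F K k" for x y
    using that chains_add unfolding boundaries_eq[OF assms] by (force simp flip: bdry_add)
  show "scal a x \<in> boundaries F K k" if "x \<in> boundaries F K k" for a x
    using that chains_scal unfolding boundaries_eq[OF assms] by (force simp flip: bdry_scal)
qed

text \<open>Since \<open>rbetti\<close> is a truncated difference, its vanishing only bounds the
  dimension of the cycles by that of the boundaries. As boundaries are cycles and the spaces are
  finite-dimensional, the two still coincide.\<close>

lemma rbetti_eq_0_iff:
  assumes "cplx K"
  shows "rbetti F K k = 0 \<longleftrightarrow> exact_at K k"
proof
  have fin: "finite K" using assms by (auto simp: cplx_def simplicial_complex_def)
  assume "rbetti F K k = 0"
  hence "chain_space.dim (cycles F K k) \<le> chain_space.dim (boundaries F K k)"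
    by (simp add: rbetti_def chain_dim_eq)
  moreover have "cycles F K k \<subseteq> chain_space.span (unit_chain ` K)"
    using mem_span_unit_chains[OF fin] by (auto simp: cycles_def dest: chains_nonzeroD)
  ultimately show "exact_at K k" unfolding exact_at_iff[OF assms]
    using fin boundaries_subset_cycles[OF assms]
    by (intro chain_space.dim_le_imp_subset[OF subspace_boundaries[OF assms]]) auto
next
  assume "exact_at K k"
  hence "cycles F K k = boundaries F K k"
    using boundaries_subset_cycles[OF assms] exact_at_iff[OF assms] by blast
  thus "rbetti F K k = 0" by (simp add: rbetti_def)
qed

lemma dim_boundaries_top:
  assumes "cplx K" "\<And>\<sigma>. \<sigma> \<in> K \<Longrightarrow> card \<sigma> \<le> n"
  shows "chain_dim F (boundaries F K n) = 0"
proof -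
  have "c = 0" if "c \<in> chains F K (Suc n)" for c :: "'a set \<Rightarrow> 'k"
    by (rule chains_eq_0[OF that]) (use assms(2) in fastforce)
  hence "boundaries F K n \<subseteq> chain_space.span {}" unfolding boundaries_eq[OF assms(1)] by fastforce
  from chain_space.dim_le_card[OF this] show ?thesis by (simp add: chain_dim_eq)
qed

lemma rbetti_1_top_line:
  assumes K: "cplx K" and n: "\<And>\<sigma>. \<sigma> \<in> K \<Longrightarrow> card \<sigma> \<le> n" and r: "rbetti F K n = 1"
  shows "top_line K n"
proof -
  have "chain_space.dim (cycles F K n) = 1"
    using r dim_boundaries_top[OF K n] by (simp add: rbetti_def chain_dim_eq)
  then obtain B where B: "B \<subseteq> cycles F K n" "chain_space.independent B" "cycles F K n \<subseteq> chain_space.span B" "card B = 1"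
    using chain_space.basis_exists by metis
  then obtain z where z: "B = {z}" by (auto simp: card_1_singleton_iff)
  have "z \<noteq> 0" using B(2) z chain_space.dependent_zero by auto
  moreover have "\<exists>a. c = scal a z" if "c \<in> cycles F K n" for c
    using that B(3) z chain_space.span_singleton[of z] by auto
  ultimately show ?thesis using B(1) z unfolding top_line_def cycles_eq[OF K] by blast
qed

lemma top_line_rbetti:
  assumes K: "cplx K" and n: "\<And>\<sigma>. \<sigma> \<in> K \<Longrightarrow> card \<sigma> \<le> n" and t: "top_line K n"
  shows "rbetti F K n = 1"
proof -
  obtain z where z: "z \<in> cycles F K n" "z \<noteq> 0" "\<And>c. c \<in> cycles F K n \<Longrightarrow> \<exists>a. c = scal a z"
    using t unfolding top_line_def cycles_eq[OF K] by blast
  have "chain_space.dim (cycles F K n) = 1"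
  proof (rule chain_space.dim_unique)
    show "{z} \<subseteq> cycles F K n" using z by simp
    show "cycles F K n \<subseteq> chain_space.span {z}" using z(3) by (auto simp: chain_space.span_singleton)
    show "chain_space.independent {z}" using z(2) by (simp add: chain_space.dependent_single)
  qed simp
  thus ?thesis using dim_boundaries_top[OF K n] by (simp add: rbetti_def chain_dim_eq)
qed

lemma betti_size: "betti F K (int k - 1) = rbetti F K k"
  by (simp add: betti_def)

lemma acyclic_iff: "cplx K \<Longrightarrow> acyclic F K \<longleftrightarrow> (\<forall>k. exact_at K k)"
proof -
  assume K: "cplx K"
  show ?thesis
  proof
    assume "acyclic F K"
    thus "\<forall>k. exact_at K k" using rbetti_eq_0_iff[OF K] by (metis acyclic_def betti_size)
  next
    assume "\<forall>k. exact_at K k"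
    thus "acyclic F K" using rbetti_eq_0_iff[OF K] by (simp add: acyclic_def betti_def)
  qed
qed

lemma Max_card_cplx:
  assumes "cplx K" "\<sigma> \<in> K" "card \<sigma> = n" "\<And>\<tau>. \<tau> \<in> K \<Longrightarrow> card \<tau> \<le> n"
  shows "cdim K = int n - 1"
proof -
  have "finite K" using assms by (auto simp: cplx_def simplicial_complex_def)
  hence "Max (card ` K) = n" using assms by (intro Max_eqI) auto
  thus ?thesis by (simp add: cdim_def)
qed

text \<open>The degree \<open>int n - 1 - fdim \<sigma> - 1\<close> becomes the size
  \<open>n - card \<sigma>\<close>. Links have no faces above that size, so \<open>sph\<close>
  records only what happens below it and at it.\<close>

lemma hom_sphere_sph:
  assumes S: "hom_sphere F S (int n - 1)" and SU: "S \<subseteq> Pow U"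
  shows "sph n S"
proof -
  have cS: "cplx S" and fin: "finite S" and ne: "S \<noteq> {}" and d: "cdim S = int n - 1"
    using S SU by (auto simp: hom_sphere_def cplx_def simplicial_complex_def)
  have card: "card \<sigma> \<le> n" if "\<sigma> \<in> S" for \<sigma>
  proof -
    have "card \<sigma> \<le> Max (card ` S)" by (rule Max_ge) (use that fin in auto)
    thus ?thesis using d by (simp add: cdim_def)
  qed
  have hom: "betti F (link S \<sigma>) i = (if i = int n - 1 - fdim \<sigma> - 1 then 1 else 0)" if "\<sigma> \<in> S" for \<sigma> i
    using S that by (auto simp: hom_sphere_def sphere_homology_def)
  have "(\<forall>k < n - card \<sigma>. exact_at (link S \<sigma>) k) \<and> top_line (link S \<sigma>) (n - card \<sigma>)" if \<sigma>: "\<sigma> \<in> S" for \<sigma>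
  proof (intro conjI allI impI)
    note cl = cplx_link[OF cS, of \<sigma>]
    fix k assume "k < n - card \<sigma>"
    hence "betti F (link S \<sigma>) (int k - 1) = 0" using card[OF \<sigma>] by (subst hom[OF \<sigma>]) (simp add: fdim_def)
    thus "exact_at (link S \<sigma>) k" using rbetti_eq_0_iff[OF cl] by (simp add: betti_size)
  next
    note cl = cplx_link[OF cS, of \<sigma>]
    have "betti F (link S \<sigma>) (int (n - card \<sigma>) - 1) = 1"
      using card[OF \<sigma>] by (subst hom[OF \<sigma>]) (simp add: fdim_def)
    hence "rbetti F (link S \<sigma>) (n - card \<sigma>) = 1" by (simp only: betti_size)
    moreover have "card \<tau> \<le> n - card \<sigma>" if "\<tau> \<in> link S \<sigma>" for \<tau>
    proof -
      have t: "\<tau> \<inter> \<sigma> = {}" "\<tau> \<union> \<sigma> \<in> S" using that by (auto simp: mem_link)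
      have "card (\<tau> \<union> \<sigma>) = card \<tau> + card \<sigma>"
        using t cplx_face[OF cS t(2)] by (intro card_Un_disjoint) auto
      thus ?thesis using card[OF t(2)] by simp
    qed
    ultimately show "top_line (link S \<sigma>) (n - card \<sigma>)" by (intro rbetti_1_top_line[OF cl])
  qed
  moreover have "{} \<in> S" using ne cplx_downward[OF cS, of _ "{}"] by auto
  ultimately show ?thesis using cS card by (simp add: sph_def)
qed

lemma sph_cdim: "sph n S \<Longrightarrow> cdim S = int n - 1"
proof -
  assume S: "sph n S"
  obtain \<tau> where "\<tau> \<in> S" "card \<tau> = n" using sph_facet[OF S, of "{}"] S by (auto simp: sph_def)
  thus ?thesis using Max_card_cplx[OF sph_cplx[OF S]] sph_card[OF S] by blast
qed

lemma hom_sphere_vertex_link: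
  assumes S: "hom_sphere F S (int n - 1)" and SU: "S \<subseteq> Pow U" and w: "{w} \<in> S"
  shows "hom_sphere F (link S {w}) (int n - 2)"
proof -
  have s: "sph n S" by (rule hom_sphere_sph[OF S SU])
  have l: "sph (n - 1) (link S {w})" using sph_link[OF s w] by simp
  have "1 \<le> n" using sph_card[OF s w] by simp
  hence "cdim (link S {w}) = int n - 2" using sph_cdim[OF l] by simp
  moreover have "sphere_homology F (link (link S {w}) \<sigma>) (int n - 2 - fdim \<sigma> - 1)" if \<sigma>: "\<sigma> \<in> link S {w}" for \<sigma>
  proof -
    have "w \<notin> \<sigma>" "insert w \<sigma> \<in> S" "finite \<sigma>"
      using \<sigma> cplx_face[OF sph_cplx[OF l] \<sigma>] by (auto simp: mem_link)
    moreover have "sphere_homology F (link S (insert w \<sigma>)) (int n - 1 - fdim (insert w \<sigma>) - 1)"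
      using S calculation by (auto simp: hom_sphere_def)
    ultimately show ?thesis by (simp add: link_link fdim_def)
  qed
  moreover have "link S {w} \<noteq> {}" "simplicial_complex (link S {w})"
    using l by (auto simp: sph_def cplx_def)
  ultimately show ?thesis by (simp add: hom_sphere_def)
qed

text \<open>The two points form the link of an interior face with \<open>n\<close> vertices in a
  filling; their homology shows that such a face is not on the boundary.\<close>

lemma two_points_homology:
  assumes xy: "x \<noteq> y" "x \<in> U" "y \<in> U"
  shows "sphere_homology F {{}, {x}, {y}} 0"
proof -
  let ?K = "{{}, {x}, {y}}"
  have cK: "cplx ?K" by (rule cplxI) (use xy in auto)
  have ux: "unit_chain {x} \<in> chains F ?K 1" and uy: "unit_chain {y} \<in> chains F ?K 1"
    using unit_chain_chains[of "{x}" ?K F] unit_chain_chains[of "{y}" ?K F] by simp_all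
  have e0: "exact_at ?K 0" unfolding exact_at_def
  proof (intro ballI impI)
    fix c :: "'a set \<Rightarrow> 'k" assume "c \<in> chains F ?K 0"
    hence "c \<sigma> = 0" if "\<sigma> \<noteq> {}" for \<sigma> using that chains_nonzeroD[of c F ?K 0 \<sigma>] by auto
    hence "bdry (scal (c {}) (unit_chain {x})) = c"
      using xy by (auto simp: bdry_scal bdry_unit_chain_singleton scal_def unit_chain_def)
    thus "\<exists>b\<in>chains F ?K (Suc 0). bdry b = c" using chains_scal[OF ux, of "c {}"] by auto
  qed
  have "top_line ?K 1" unfolding top_line_def
  proof (intro bexI conjI ballI impI)
    show z: "unit_chain {x} - unit_chain {y} \<in> chains F ?K 1" by (rule chains_diff[OF ux uy])
    have "(unit_chain {x} - unit_chain {y}) {x} = (1::'k)" using xy by (simp add: unit_chain_def)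
    thus "unit_chain {x} - unit_chain {y} \<noteq> (0 :: 'a set \<Rightarrow> 'k)" by (metis zero_fun_apply zero_neq_one)
    show "bdry (unit_chain {x} - unit_chain {y}) = 0"
      using xy by (simp add: bdry_diff bdry_unit_chain_singleton)
    fix c :: "'a set \<Rightarrow> 'k" assume c: "c \<in> chains F ?K 1" "bdry c = 0"
    have "c \<sigma> = 0" if "\<sigma> \<noteq> {x}" "\<sigma> \<noteq> {y}" for \<sigma> using that chains_nonzeroD[OF c(1), of \<sigma>] by auto
    hence eq: "c = scal (c {x}) (unit_chain {x}) + scal (c {y}) (unit_chain {y})"
      using xy by (intro ext) (auto simp: scal_def unit_chain_def)
    hence "bdry c = scal (c {x}) (unit_chain {}) + scal (c {y}) (unit_chain {})"
      using xy by (metis bdry_add bdry_scal bdry_unit_chain_singleton)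
    hence "c {x} + c {y} = 0" using fun_cong[OF c(2), of "{}"] by (simp add: scal_def unit_chain_def)
    hence "c {y} = - c {x}" by (simp add: eq_neg_iff_add_eq_0 add.commute)
    have "c \<sigma> = scal (c {x}) (unit_chain {x} - unit_chain {y}) \<sigma>" for \<sigma>
    proof -
      have "c \<sigma> = c {x} * unit_chain {x} \<sigma> + c {y} * unit_chain {y} \<sigma>"
        using fun_cong[OF eq, of \<sigma>] by (simp only: scal_def plus_fun_apply)
      also have "\<dots> = scal (c {x}) (unit_chain {x} - unit_chain {y}) \<sigma>"
        unfolding \<open>c {y} = - c {x}\<close> scal_def minus_apply by (simp add: right_diff_distrib)
      finally show ?thesis .
    qed
    thus "\<exists>a. c = scal a (unit_chain {x} - unit_chain {y})" by blast
  qed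
  hence r1: "rbetti F ?K 1 = 1" by (intro top_line_rbetti[OF cK]) auto
  have r: "rbetti F ?K k = 0" if "k \<noteq> 1" for k
    unfolding rbetti_eq_0_iff[OF cK]
  proof (cases "k = 0")
    case False
    show "exact_at ?K k" unfolding exact_at_def
    proof (intro ballI impI)
      fix c :: "'a set \<Rightarrow> 'k" assume "c \<in> chains F ?K k"
      hence "c = 0" by (rule chains_eq_0) (use False that in auto)
      thus "\<exists>b\<in>chains F ?K (Suc k). bdry b = c" by (intro bexI[of _ 0]) (simp only: bdry_0, rule chains_0)
    qed
  qed (use e0 in simp)
  show ?thesis unfolding sphere_homology_def
  proof
    fix i :: int
    show "betti F ?K i = (if i = 0 then 1 else 0)"
    proof (cases "i < -1")
      case False
      hence "betti F ?K i = rbetti F ?K (nat (i + 1))" by (simp add: betti_def)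
      moreover have "nat (i + 1) = 1 \<longleftrightarrow> i = 0" by linarith
      ultimately show ?thesis using r1 r by simp
    qed (simp add: betti_def)
  qed
qed

subsection \<open>Stackedness of tight vertex links\<close>

text \<open>Faces of \<open>S\<close> have acyclic links in \<open>B\<close>, while the other faces
  with at most \<open>n\<close> vertices have links with the homology of a zero-sphere; this
  identifies the boundary of \<open>B\<close> with \<open>S\<close>. Vertex links are balls by the
  same dichotomy, applied to the faces containing the vertex.\<close>

lemma stacked_filling_stacked_sphere:
  assumes hS: "hom_sphere F S (int n - 1)" and SU: "S \<subseteq> Pow U" and n: "2 \<le> n"
    and B: "stacked_filling n S B"
  shows "stacked_sphere F S (int n - 1)"
proof -
  have S: "sph n S" by (rule hom_sphere_sph[OF hS SU])
  note cS = sph_cplx[OF S]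
  have cB: "cplx B" and SB: "S \<subseteq> B" and UB: "\<Union>B \<subseteq> \<Union>S" and cardB: "\<And>\<sigma>. \<sigma> \<in> B \<Longrightarrow> card \<sigma> \<le> Suc n"
    and facet: "\<exists>\<sigma>\<in>B. card \<sigma> = Suc n"
    and S1: "\<And>\<sigma> k. \<sigma> \<in> S \<Longrightarrow> exact_at (link B \<sigma>) k" and Sn: "\<And>\<sigma>. \<sigma> \<in> S \<Longrightarrow> card \<sigma> \<le> n"
    and S2: "\<And>\<sigma>. \<sigma> \<in> S \<Longrightarrow> card \<sigma> = n \<Longrightarrow> \<exists>x. link B \<sigma> = {{}, {x}}"
    and B1: "\<And>\<sigma>. \<sigma> \<in> B \<Longrightarrow> \<sigma> \<notin> S \<Longrightarrow> card \<sigma> = Suc n \<or> card \<sigma> = n \<and> (\<exists>x y. x \<noteq> y \<and> link B \<sigma> = {{}, {x}, {y}})"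
    using B unfolding stacked_filling_def by auto
  have acy: "acyclic F (link B \<sigma>)" if "\<sigma> \<in> S" for \<sigma>
    using S1[OF that] acyclic_iff[OF cplx_link[OF cB]] by blast
  have sphere: "card \<sigma> = n \<and> sphere_homology F (link B \<sigma>) 0" if \<sigma>: "\<sigma> \<in> B" "\<sigma> \<notin> S" "card \<sigma> \<le> n" for \<sigma>
  proof -
    obtain x y where xy: "card \<sigma> = n" "x \<noteq> y" "link B \<sigma> = {{}, {x}, {y}}" using B1[OF \<sigma>(1,2)] \<sigma>(3) by auto
    hence "{x} \<in> link B \<sigma>" "{y} \<in> link B \<sigma>" by auto
    hence "x \<in> U" "y \<in> U" using cplx_face[OF cplx_link[OF cB]] by blast+
    thus ?thesis using xy two_points_homology by simp
  qed
  \<comment> \<open>As \<open>B\<close> has dimension \<open>n\<close>, the degree tested by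
    \<open>hbdry\<close> is \<open>n - card \<sigma>\<close>; for the interior faces considered here
    it is \<open>0\<close>.\<close>
  have bdry_iff: "\<sigma> \<in> S \<longleftrightarrow> betti F (link B \<sigma>) (int n - int (card \<sigma>)) = 0" if "\<sigma> \<in> B" "card \<sigma> \<le> n" for \<sigma>
  proof
    assume "\<sigma> \<in> S"
    thus "betti F (link B \<sigma>) (int n - int (card \<sigma>)) = 0" using acy by (simp add: acyclic_def)
  next
    assume b0: "betti F (link B \<sigma>) (int n - int (card \<sigma>)) = 0"
    show "\<sigma> \<in> S"
    proof (rule ccontr)
      assume "\<sigma> \<notin> S"
      from sphere[OF that(1) this that(2)] b0 show False by (simp add: sphere_homology_def)
    qed
  qed
  have e: "{} \<in> S" using S by (simp add: sph_def)
  have pos: "0 < card \<sigma> \<longleftrightarrow> \<sigma> \<noteq> {}" if "\<sigma> \<in> B" for \<sigma> using cplx_face[OF cB that] by (auto simp: card_gt_0_iff)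
  have hb: "hbdry F B (int n) = S"
  proof
    show "hbdry F B (int n) \<subseteq> S"
      using bdry_iff e by (auto simp: hbdry_def fdim_def)
    show "S \<subseteq> hbdry F B (int n)"
    proof
      fix \<sigma> assume \<sigma>: "\<sigma> \<in> S"
      hence "\<sigma> \<in> B" "card \<sigma> \<le> n" using SB Sn by auto
      thus "\<sigma> \<in> hbdry F B (int n)" using bdry_iff[of \<sigma>] \<sigma> pos[of \<sigma>] by (auto simp: hbdry_def fdim_def)
    qed
  qed
  have ball: "hom_ball F (link B {w}) (int n - 1)" if w: "{w} \<in> B" for w
  proof -
    let ?L = "link B {w}"
    have cL: "cplx ?L" by (rule cplx_link[OF cB])
    \<comment> \<open>Every vertex of \<open>B\<close> lies on \<open>S\<close>; this is why its
      link is acyclic, as a ball has to be.\<close>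
    have wS: "{w} \<in> S"
    proof -
      have "w \<in> \<Union>S" using UB w by blast
      then obtain \<tau> where \<tau>: "\<tau> \<in> S" "w \<in> \<tau>" by blast
      show ?thesis by (rule cplx_downward[OF cS \<tau>(1)]) (use \<tau>(2) in simp)
    qed
    have L: "w \<notin> \<sigma> \<and> insert w \<sigma> \<in> B \<and> card (insert w \<sigma>) = Suc (card \<sigma>) \<and> link ?L \<sigma> = link B (insert w \<sigma>)"
      if "\<sigma> \<in> ?L" for \<sigma>
      using that cplx_face[OF cL that] by (auto simp: mem_link link_link)
    have inS: "\<sigma> \<in> link S {w} \<longleftrightarrow> insert w \<sigma> \<in> S" if "\<sigma> \<in> ?L" for \<sigma> using L[OF that] by (auto simp: mem_link)
    have subL: "link S {w} \<subseteq> ?L" using SB by (auto simp: mem_link)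
    have "cdim ?L = int n - 1"
    proof -
      obtain \<tau> where \<tau>: "\<tau> \<in> S" "{w} \<subseteq> \<tau>" "card \<tau> = n" by (rule sph_facet[OF S wS])
      obtain x where "link B \<tau> = {{}, {x}}" using S2[OF \<tau>(1,3)] by blast
      hence "{x} \<in> link B \<tau>" by simp
      hence x: "x \<notin> \<tau>" "insert x \<tau> \<in> B" by (auto simp: mem_link)
      have f: "finite \<tau>" using cplx_face[OF cS \<tau>(1)] by simp
      show ?thesis
      proof (rule Max_card_cplx[OF cL])
        show "insert x \<tau> - {w} \<in> ?L" using x \<tau>(2) by (auto simp: mem_link insert_absorb)
        show "card (insert x \<tau> - {w}) = n" using x f \<tau> by (simp add: card_Diff_singleton)
        show "card \<sigma> \<le> n" if "\<sigma> \<in> ?L" for \<sigma> using L[OF that] cardB[of "insert w \<sigma>"] by simp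
      qed
    qed
    moreover have "acyclic F (link ?L \<sigma>) \<or> sphere_homology F (link ?L \<sigma>) (int n - 1 - fdim \<sigma> - 1)"
      if "\<sigma> \<in> ?L" "fdim \<sigma> \<le> int n - 1 - 1" for \<sigma>
      using L[OF that(1)] acy[of "insert w \<sigma>"] sphere[of "insert w \<sigma>"] that(2)
      by (cases "insert w \<sigma> \<in> S") (auto simp: fdim_def)
    moreover have "hbdry F ?L (int n - 1) = link S {w}"
    proof
      show "hbdry F ?L (int n - 1) \<subseteq> link S {w}"
      proof
        fix \<sigma> assume "\<sigma> \<in> hbdry F ?L (int n - 1)"
        then consider "\<sigma> = {}" | "\<sigma> \<in> ?L" "fdim \<sigma> < int n - 1" "betti F (link ?L \<sigma>) (int n - 1 - fdim \<sigma> - 1) = 0"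
          by (auto simp: hbdry_def)
        thus "\<sigma> \<in> link S {w}"
        proof cases
          case 1
          thus ?thesis using wS by (simp add: mem_link)
        next
          case 2
          have "insert w \<sigma> \<in> S"
            using L[OF 2(1)] 2(2,3) by (subst bdry_iff) (auto simp: fdim_def algebra_simps)
          thus ?thesis using inS[OF 2(1)] by simp
        qed
      qed
      show "link S {w} \<subseteq> hbdry F ?L (int n - 1)"
      proof
        fix \<sigma> assume \<sigma>: "\<sigma> \<in> link S {w}"
        hence \<sigma>L: "\<sigma> \<in> ?L" using subL by auto
        have wS': "insert w \<sigma> \<in> S" using \<sigma> inS[OF \<sigma>L] by simp
        have "card \<sigma> < n" using Sn[OF wS'] L[OF \<sigma>L] by simp
        moreover have "betti F (link ?L \<sigma>) i = 0" for i using acy[OF wS'] L[OF \<sigma>L] by (simp add: acyclic_def)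
        moreover have "\<sigma> = {} \<or> 0 < card \<sigma>" using cplx_face[OF cL \<sigma>L] by (auto simp: card_gt_0_iff)
        ultimately show "\<sigma> \<in> hbdry F ?L (int n - 1)" using \<sigma>L by (auto simp: hbdry_def fdim_def)
      qed
    qed
    moreover have "hom_sphere F (link S {w}) (int n - 1 - 1)"
      using hom_sphere_vertex_link[OF hS SU wS] by simp
    moreover have "?L \<noteq> {}" using w by (auto simp: mem_link)
    moreover have "acyclic F ?L" by (rule acy[OF wS])
    ultimately show ?thesis using cL by (simp add: hom_ball_def cplx_def)
  qed
  have "cdim B = int n" using facet Max_card_cplx[OF cB _ _ cardB] by fastforce
  hence mB: "hom_manifold F B (int n)" using cB facet ball
    by (auto simp: hom_manifold_def cplx_def vertices_def)
  obtain \<tau> where \<tau>: "\<tau> \<in> S" "card \<tau> = n" using sph_facet[OF S e] by blast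
  have "\<tau> \<noteq> {}" using \<tau>(2) n by auto
  hence "hbdry F B (int n) \<noteq> {{}}" using hb \<tau> by auto
  moreover have "fdim \<sigma> \<ge> int n - 1" if "\<sigma> \<in> B" "\<sigma> \<notin> S" for \<sigma> using B1[OF that] by (auto simp: fdim_def)
  ultimately have sB: "stacked_with_boundary F B (int n)" using mB hb by (simp add: stacked_with_boundary_def)
  have "hom_manifold F S (int n - 1)"
    using hS hom_sphere_vertex_link[OF hS SU] by (auto simp: hom_manifold_def hom_sphere_def[of F S] vertices_def)
  \<comment> \<open>Every link in the sphere \<open>S\<close> has Betti number one in the degree
    tested by \<open>hbdry\<close>, so only the empty face remains.\<close>
  moreover have "hbdry F S (int n - 1) = {{}}"
    using hS by (auto simp: hbdry_def hom_sphere_def sphere_homology_def)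
  ultimately have "closed_manifold F S (int n - 1)" by (simp add: closed_manifold_def)
  thus ?thesis using hS sB hb unfolding stacked_sphere_def stacked_closed_def by auto
qed

lemma tight_vertex_link_hollow:
  assumes K: "cplx K" and t: "tight F K" and b: "\<And>k. 3 \<le> k \<Longrightarrow> k < n \<Longrightarrow> exact_at K k" and v: "{v} \<in> K"
  shows "hollow n (link K {v})"
  unfolding hollow_def
proof (intro allI impI)
  fix W k assume k: "2 \<le> k \<and> k + 2 \<le> n"
  let ?S = "link K {v}" let ?W = "W - {v}"
  have vU: "v \<in> U" using cplx_face[OF K v] by auto
  \<comment> \<open>Tightness in terms of \<open>bdry\<close> and for arbitrary \<open>W\<close>:
    elements that are not vertices of \<open>K\<close> do not change the induced subcomplex.\<close>
  have tight: "c \<in> bdry ` chains F (induced K W) (Suc k)"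
    if c: "c \<in> chains F (induced K W) k" "bdry c = 0" "c \<in> bdry ` chains F K (Suc k)" "1 \<le> k" for c k W
  proof -
    have eq: "induced K W = induced K (W \<inter> vertices K)"
    proof -
      have "\<alpha> \<subseteq> vertices K" if "\<alpha> \<in> K" for \<alpha> using cplx_downward[OF K that] by (auto simp: vertices_def)
      thus ?thesis by (auto simp: mem_induced)
    qed
    have cI: "cplx (induced K (W \<inter> vertices K))" by (rule cplx_induced[OF K])
    have "c \<in> cycles F (induced K (W \<inter> vertices K)) k \<and> c \<in> boundaries F K k"
      using c eq cycles_eq[OF cI] boundaries_eq[OF K] by auto
    hence "c \<in> boundaries F (induced K (W \<inter> vertices K)) k"
      using t c(4) unfolding tight_def by (meson inf_le2)
    thus ?thesis using boundaries_eq[OF cI] eq by simp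
  qed
  show "exact_at (induced ?S W) k" unfolding exact_at_def
  proof (intro ballI impI)
    fix c assume c: "c \<in> chains F (induced ?S W) k" "bdry c = 0"
    have sub: "\<sigma> \<in> K \<and> v \<notin> \<sigma> \<and> \<sigma> \<subseteq> W \<and> insert v \<sigma> \<in> K" if "\<sigma> \<in> induced ?S W" for \<sigma>
      using that link_subset[OF K, of "{v}"] by (auto simp: mem_induced mem_link)
    have nv: "c \<sigma> = 0" if "v \<in> \<sigma>" for \<sigma> using chains_nonzeroD[OF c(1), of \<sigma>] sub[of \<sigma>] that by auto
    have car: "carried c" by (rule cplx_carried[OF cplx_induced[OF cplx_link[OF K]] c(1)])
    have bc: "bdry (cone v c) = c" using bdry_cone[OF car vU nv] c(2) by simp
    have cone: "cone v c \<in> chains F (induced K (insert v W)) (Suc k)"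
      by (rule cone_chains[OF c(1)]) (use sub in \<open>fastforce simp: mem_induced\<close>)
    have "cone v c \<in> chains F K (Suc k)" by (rule chains_mono[OF cone]) (auto simp: mem_induced)
    hence "c \<in> bdry ` chains F K (Suc k)" using bc by (metis image_eqI)
    moreover have "c \<in> chains F (induced K ?W) k"
      by (rule chains_mono[OF c(1)]) (use sub in \<open>auto simp: mem_induced\<close>)
    ultimately obtain a where a: "a \<in> chains F (induced K ?W) (Suc k)" "bdry a = c"
      using tight[of c ?W k] c(2) k by auto
    have a': "a \<in> chains F (induced K (insert v W)) (Suc k)"
      by (rule chains_mono[OF a(1)]) (auto simp: mem_induced)
    let ?d = "cone v c - a"
    have d: "?d \<in> chains F (induced K (insert v W)) (Suc k)" "bdry ?d = 0"
      using cone a' bc a by (auto intro: chains_diff simp: bdry_diff)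
    \<comment> \<open>The vanishing hypothesis fills \<open>?d\<close> only somewhere in
      \<open>K\<close>; a second use of tightness, at size \<open>k + 1\<close>, moves the filling
      into the subcomplex induced on \<open>insert v W\<close>.\<close>
    have "?d \<in> chains F K (Suc k)" by (rule chains_mono[OF d(1)]) (auto simp: mem_induced)
    moreover have "exact_at K (Suc k)" using k by (intro b) auto
    ultimately have "?d \<in> bdry ` chains F K (Suc (Suc k))"
      using d(2) unfolding exact_at_def by (metis image_eqI)
    then obtain g where g: "g \<in> chains F (induced K (insert v W)) (Suc (Suc k))" "bdry g = ?d"
      using tight[OF d] by auto
    \<comment> \<open>The chain \<open>a\<close> avoids \<open>v\<close>, so contraction by
      \<open>v\<close> recovers \<open>c\<close> from \<open>?d\<close>; the sign in
      \<open>linkpart_bdry\<close> explains the minus in the filling below.\<close>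
    have "linkpart v a = 0"
      by (rule linkpart_eq_0) (use chains_nonzeroD[OF a(1)] in \<open>auto simp: mem_induced\<close>)
    hence "linkpart v ?d = c" using linkpart_cone[of v c] nv by (simp add: linkpart_diff)
    hence "bdry (- linkpart v g) = c"
      using linkpart_bdry[OF cplx_carried[OF cplx_induced[OF K] g(1)], of v] g(2) by (simp add: bdry_minus)
    moreover have "linkpart v g \<in> chains F (induced ?S W) (Suc k)"
      by (rule chains_mono[OF linkpart_chains[OF g(1)]]) (auto simp: mem_induced mem_link)
    ultimately show "\<exists>b\<in>chains F (induced ?S W) (Suc k). bdry b = c" using chains_minus by blast
  qed
qed

end

theorem theorem5p3:
  fixes F :: "'k::field itself" and K :: "'a::linorder set set" and d :: int
  assumes "d \<ge> 4"
    and "tight F K"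
    and "connected_complex K"
    and "closed_manifold F K d"
    and "\<forall>i. 1 < i \<and> i < d - 1 \<longrightarrow> betti F K i = 0"
  shows "locally_stacked F K d \<and> (\<forall>v\<in>vertices K. stacked_sphere F (link K {v}) (d - 1))"
proof -
  have mK: "hom_manifold F K d" and bK: "hbdry F K d = {{}}" using assms(4) by (auto simp: closed_manifold_def)
  have sc: "simplicial_complex K" using mK by (simp add: hom_manifold_def)
  have "finite \<sigma>" if "\<sigma> \<in> K" for \<sigma>
  proof -
    \<comment> \<open>Finiteness of faces is not part of \<open>simplicial_complex\<close>; an
      infinite face would put infinitely many subsets into the finite set \<open>K\<close>.\<close>
    have "Pow \<sigma> \<subseteq> K" using sc that by (auto simp: simplicial_complex_def)
    moreover have "finite K" using sc by (simp add: simplicial_complex_def)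
    ultimately have "finite (Pow \<sigma>)" by (rule finite_subset)
    thus ?thesis by simp
  qed
  hence fin: "finite (\<Union>K)" using sc by (auto simp: simplicial_complex_def)
  interpret ground "\<Union>K" F by unfold_locales (rule fin)
  have cK: "cplx K" using sc by (auto simp: cplx_def)
  define n where "n = nat d"
  have n: "d = int n" "4 \<le> n" using assms(1) by (auto simp: n_def)
  \<comment> \<open>Size \<open>k\<close> is degree \<open>k - 1\<close>, so
    \<open>3 \<le> k < n\<close> is the range \<open>1 < i < d - 1\<close> of the
    hypothesis.\<close>
  have ex: "exact_at K k" if "3 \<le> k" "k < n" for k
  proof -
    have "betti F K (int k - 1) = 0" using assms(5) that n by auto
    thus ?thesis using rbetti_eq_0_iff[OF cK] by (simp add: betti_size)
  qed
  have stacked: "stacked_sphere F (link K {v}) (d - 1)" if "v \<in> vertices K" for v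
  proof -
    have v: "{v} \<in> K" using that by (simp add: vertices_def)
    \<comment> \<open>A ball is acyclic, which would put \<open>{v}\<close> into the boundary; for a
      closed manifold this consists of the empty face only.\<close>
    have "\<not> hom_ball F (link K {v}) (d - 1)"
    proof
      assume "hom_ball F (link K {v}) (d - 1)"
      hence "betti F (link K {v}) (d - fdim {v} - 1) = 0" by (simp add: hom_ball_def acyclic_def)
      hence "{v} \<in> hbdry F K d" using v assms(1) by (simp add: hbdry_def fdim_def)
      thus False using bK by simp
    qed
    hence hS: "hom_sphere F (link K {v}) (int n - 1)" using mK that n by (auto simp: hom_manifold_def)
    have SU: "link K {v} \<subseteq> Pow (\<Union>K)" using cplx_link[OF cK] by (simp add: cplx_def)
    obtain B where "stacked_filling n (link K {v}) B"
      using stacked_filling_exists[OF hom_sphere_sph[OF hS SU] n(2) tight_vertex_link_hollow[OF cK assms(2) ex v]]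
      by blast
    thus ?thesis using stacked_filling_stacked_sphere[OF hS SU] n by simp
  qed
  thus ?thesis using mK by (auto simp: locally_stacked_def)
qed

end
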